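(* Let $K$ be one of the fields $\mathbb{Q}_2(\sqrt{2}),\ \mathbb{Q}_2(\sqrt{10}),\ \mathbb{Q}_2(\sqrt{-2}),\ \mathbb{Q}_2(\sqrt{-10})$. Then $\Gamma^*(4,K)=11$. That is: every additive form $a_1x_1^4+\cdots+a_sx_s^4$ with $a_i\in K$ and $s\ge 11$ has a nontrivial zero in $K^s$, and there exist $a_1,\dots,a_{10}\in K$ such that $a_1x_1^4+\cdots+a_{10}x_{10}^4$ has no nontrivial zero in $K^{10}$.
   Context: For a field $K$ and integer $d\ge1$, $\Gamma^*(d,K)$ denotes the least integer $s$ such that every additive form $a_1x_1^d+\cdots+a_sx_s^d$ with coefficients $a_i\in K$ has a nontrivial zero (a zero in $K^s$ other than $(0,\dots,0)$). *)

theory Defs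
  imports Complex_Main "HOL-Computational_Algebra.Primes"
begin

definition val2 :: "rat \<Rightarrow> int" where
  "val2 r = int (multiplicity (2::int) (fst (quotient_of r)))
      - int (multiplicity (2::int) (snd (quotient_of r)))"

definition small2 :: "int \<Rightarrow> rat \<Rightarrow> bool" where
  "small2 k r \<longleftrightarrow> r = 0 \<or> k \<le> val2 r"

definition cauchy2 :: "(nat \<Rightarrow> rat) \<Rightarrow> bool" where
  "cauchy2 X \<longleftrightarrow> (\<forall>k. \<exists>N. \<forall>m\<ge>N. \<forall>n\<ge>N. small2 k (X m - X n))"

definition null2 :: "(nat \<Rightarrow> rat) \<Rightarrow> bool" where
  "null2 X \<longleftrightarrow> (\<forall>k. \<exists>N. \<forall>n\<ge>N. small2 k (X n))"

(* (p, q) represents p + q * sqrt d in Q(sqrt d) *)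
definition qmul :: "int \<Rightarrow> rat \<times> rat \<Rightarrow> rat \<times> rat \<Rightarrow> rat \<times> rat" where
  "qmul d x y = (fst x * fst y + of_int d * snd x * snd y, fst x * snd y + snd x * fst y)"

primrec qpow :: "int \<Rightarrow> rat \<times> rat \<Rightarrow> nat \<Rightarrow> rat \<times> rat" where
  "qpow d x 0 = (1, 0)"
| "qpow d x (Suc n) = qmul d x (qpow d x n)"

(* An element of K = Q_2(sqrt d) = Q_2 + Q_2 sqrt d (d a non-square in Q_2) is
   represented by a sequence of elements p_n + q_n sqrt d of Q(sqrt d) with
   (p_n), (q_n) both 2-adically Cauchy; it is zero iff both are 2-adic null sequences.
   All field operations are computed termwise. *)
definition is_K_elem :: "(nat \<Rightarrow> rat \<times> rat) \<Rightarrow> bool" where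
  "is_K_elem X \<longleftrightarrow> cauchy2 (\<lambda>n. fst (X n)) \<and> cauchy2 (\<lambda>n. snd (X n))"

definition is_K_zero :: "(nat \<Rightarrow> rat \<times> rat) \<Rightarrow> bool" where
  "is_K_zero X \<longleftrightarrow> null2 (\<lambda>n. fst (X n)) \<and> null2 (\<lambda>n. snd (X n))"

definition diag_form ::
  "int \<Rightarrow> nat \<Rightarrow> nat \<Rightarrow> (nat \<Rightarrow> nat \<Rightarrow> rat \<times> rat) \<Rightarrow> (nat \<Rightarrow> nat \<Rightarrow> rat \<times> rat)
     \<Rightarrow> nat \<Rightarrow> rat \<times> rat" where
  "diag_form d e s a x = (\<lambda>n.
     ((\<Sum>i<s. fst (qmul d (a i n) (qpow d (x i n) e))),
      (\<Sum>i<s. snd (qmul d (a i n) (qpow d (x i n) e)))))"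

definition has_nontrivial_zero ::
  "int \<Rightarrow> nat \<Rightarrow> nat \<Rightarrow> (nat \<Rightarrow> nat \<Rightarrow> rat \<times> rat) \<Rightarrow> bool" where
  "has_nontrivial_zero d e s a \<longleftrightarrow>
     (\<exists>x. (\<forall>i<s. is_K_elem (x i)) \<and> (\<exists>i<s. \<not> is_K_zero (x i))
          \<and> is_K_zero (diag_form d e s a x))"

definition Gamma_star :: "int \<Rightarrow> nat \<Rightarrow> nat" where
  "Gamma_star d e = (LEAST s. \<forall>a. (\<forall>i<s. is_K_elem (a i)) \<longrightarrow> has_nontrivial_zero d e s a)"

end

theory Submission
  imports Defs
begin

text \<open>
  The element \<open>w = \<surd>d\<close> is a uniformizer of \<open>K\<close>, the residue field is \<open>\<int>/2\<close> and \<open>2\<close> has valuation \<open>2\<close>.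
  Every unit congruent to \<open>1\<close> modulo \<open>w\<^sup>7\<close> is a fourth power, so it suffices to find zeros modulo \<open>w\<^sup>7\<close>
  in which some variable with unit coefficient takes a unit value.
  Scaling the variables moves the valuations of the coefficients (their levels) into four consecutive
  values, and the choice of the lowest one amounts to a cyclic rotation.

  Let \<open>U\<close> be a set of coefficients, at least one of them a unit, whose sum is divisible by \<open>w\<^sup>4\<close>. Give the
  value \<open>1\<close> to their variables. The digits at \<open>w\<^sup>4\<close>, \<open>w\<^sup>5\<close>, \<open>w\<^sup>6\<close> can then be corrected by replacing some of these
  values by \<open>1 + w\<close>, as \<open>(1 + w)\<^sup>4 = 1 + w\<^sup>5 \<cdot> unit\<close>, and by giving the value \<open>w\<close> to coefficients outside of \<open>U\<close>.
  Modulo \<open>w\<^sup>4\<close> the integers of \<open>K\<close> form the group \<open>(\<int>/4)\<^sup>2\<close>; two units with the same second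
  coordinate modulo \<open>2\<close>, or two coefficients of level \<open>1\<close>, have their sum in the Klein four-group \<open>2 (\<int>/4)\<^sup>2\<close>,
  and \<open>U\<close> is composed of such pairs by linear algebra over \<open>\<int>/2\<close>. Some rotation of the levels of eleven
  coefficients always admits this.

  In the other direction, \<open>x\<^sub>1\<^sup>4 + \<dots> + x\<^sub>4\<^sup>4 + w (1 + t w) (y\<^sub>1\<^sup>4 + \<dots> + y\<^sub>6\<^sup>4)\<close> has no nontrivial zero for the right
  \<open>t \<in> {0, 1}\<close>: modulo \<open>w\<^sup>7\<close> a fourth power of an integer is \<open>1\<close>, \<open>(1 + w)\<^sup>4\<close>, \<open>w\<^sup>4\<close> or \<open>0\<close>, and counting these
  values contradicts the vanishing modulo \<open>w\<^sup>8\<close>.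
\<close>

section \<open>Valuations on the quadratic field\<close>

locale ramified =
  fixes d :: int
  assumes d_mod: "d mod 4 = 2"
begin

definition w :: complex where "w = csqrt (of_int d)"

text \<open>The field \<open>\<rat>(\<surd>d)\<close> is realised inside the complex numbers as \<open>F\<close>. The fractional ideal \<open>w\<^sup>k O\<close> is \<open>J k\<close>,
  and \<open>E k\<close> consists of the elements of valuation exactly \<open>k\<close>.\<close>

definition O_ring :: "complex set" where
  "O_ring = {(of_int a + of_int b * w) / of_int c | a b c. odd c}"

definition J :: "int \<Rightarrow> complex set" where
  "J k = {x. x / w powi k \<in> O_ring}"

definition E :: "int \<Rightarrow> complex set" where
  "E k = J k - J (k + 1)"

definition F :: "complex set" where
  "F = {(of_int a + of_int b * w) / of_int c | a b c. c \<noteq> 0}"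

lemma w_sq: "w * w = of_int d" "w ^ 2 = of_int d"
  by (simp_all add: w_def flip: power2_eq_square)

lemma d_half: obtains u where "d = 2 * u" "odd u"
proof
  show "d = 2 * (d div 2)" "odd (d div 2)" using d_mod by presburger+
qed

lemma d_nz: "d \<noteq> 0" using d_mod by auto

lemma w_nz [simp]: "w \<noteq> 0"
  using d_nz by (simp add: w_def)

lemma O_intI: "x = (of_int a + of_int b * w) / of_int c \<Longrightarrow> odd c \<Longrightarrow> x \<in> O_ring"
  unfolding O_ring_def by blast

lemma O_add: assumes "x \<in> O_ring" "y \<in> O_ring" shows "x + y \<in> O_ring"
proof -
  obtain a b c where x: "x = (of_int a + of_int b * w) / of_int c" "odd c"
    using assms unfolding O_ring_def by blast
  obtain a' b' c' where y: "y = (of_int a' + of_int b' * w) / of_int c'" "odd c'"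
    using assms unfolding O_ring_def by blast
  have [simp]: "c \<noteq> 0" "c' \<noteq> 0" using x y by auto
  have "x + y = (of_int (a * c' + a' * c) + of_int (b * c' + b' * c) * w) / of_int (c * c')"
    unfolding x y by (simp add: field_simps)
  moreover have "odd (c * c')" using x y by simp
  ultimately show ?thesis unfolding O_ring_def by blast
qed

lemma O_mult: assumes "x \<in> O_ring" "y \<in> O_ring" shows "x * y \<in> O_ring"
proof -
  obtain a b c where x: "x = (of_int a + of_int b * w) / of_int c" "odd c"
    using assms unfolding O_ring_def by blast
  obtain a' b' c' where y: "y = (of_int a' + of_int b' * w) / of_int c'" "odd c'"
    using assms unfolding O_ring_def by blast
  have [simp]: "c \<noteq> 0" "c' \<noteq> 0" using x y by auto
  have "x * y = (of_int a * of_int a' + of_int b * of_int b' * (w * w)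
      + (of_int a * of_int b' + of_int a' * of_int b) * w) / (of_int c * of_int c')"
    unfolding x y by (simp add: field_simps)
  also have "\<dots> = (of_int (a * a' + b * b' * d) + of_int (a * b' + a' * b) * w) / of_int (c * c')"
    by (simp add: w_sq)
  finally show ?thesis using x y by (auto intro!: O_intI[of _ _ _ "c * c'"] simp del: of_int_add of_int_mult)
qed

lemma O_int [simp]: "of_int a \<in> O_ring"
proof -
  have "of_int a = (of_int a + of_int 0 * w) / of_int 1" by simp
  then show ?thesis unfolding O_ring_def using odd_one by blast
qed

lemma O_simps [simp]: "0 \<in> O_ring" "1 \<in> O_ring" "numeral n \<in> O_ring"
  using O_int[of 0] O_int[of 1] O_int[of "numeral n"] by simp_all

lemma O_w [simp]: "w \<in> O_ring"
proof -
  have "w = (of_int 0 + of_int 1 * w) / of_int 1" by simp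
  then show ?thesis unfolding O_ring_def using odd_one by blast
qed

lemma O_uminus: "x \<in> O_ring \<Longrightarrow> - x \<in> O_ring"
  using O_mult[OF O_int[of "-1"], of x] by simp

lemma O_w_power: "k \<ge> 0 \<Longrightarrow> w powi k \<in> O_ring"
proof -
  have "w ^ n \<in> O_ring" for n by (induction n) (auto intro: O_mult)
  then show "k \<ge> 0 \<Longrightarrow> w powi k \<in> O_ring" by (simp add: power_int_def)
qed

lemma O_inv_odd: "odd c \<Longrightarrow> 1 / of_int c \<in> O_ring"
proof -
  assume "odd c"
  moreover have "1 / of_int c = (of_int 1 + of_int 0 * w) / of_int c" by simp
  ultimately show ?thesis unfolding O_ring_def by blast
qed

text \<open>Clearing the denominator and squaring yields \<open>(c - b * d) ^ 2 = a ^ 2 * d\<close>,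
  odd on the left and even on the right. So \<open>w\<close> is not a unit, which separates the
  units from \<open>J 1\<close>.\<close>

lemma one_div_w: "1 / w \<notin> O_ring"
proof
  assume "1 / w \<in> O_ring"
  then obtain a b c where *: "1 / w = (of_int a + of_int b * w) / of_int c" "odd c"
    unfolding O_ring_def by blast
  have "of_int c = of_int a * w + of_int b * (w * w)"
    using * by (auto simp: field_simps)
  then have "(of_int c - of_int b * of_int d) = of_int a * w"
    by (simp add: w_sq)
  then have "(of_int c - of_int b * of_int d) ^ 2 = (of_int a)^2 * w ^ 2"
    by (simp add: power_mult_distrib)
  then have "(of_int ((c - b * d) ^ 2) :: complex) = of_int (a ^ 2 * d)"
    by (simp add: w_sq)
  then have "(c - b * d) ^ 2 = a ^ 2 * d" by (simp only: of_int_eq_iff)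
  moreover have "even d" using d_mod by presburger
  ultimately have "even ((c - b * d) ^ 2)" by simp
  then show False using \<open>odd c\<close> \<open>even d\<close> by simp
qed

text \<open>A numerator \<open>a + b w\<close> is a unit exactly when \<open>a\<close> is odd, because its norm is \<open>a\<^sup>2 - d b\<^sup>2\<close>.\<close>

lemma O_cases:
  assumes "x \<in> O_ring"
  shows "x / w \<in> O_ring \<or> (x \<noteq> 0 \<and> 1 / x \<in> O_ring)"
proof -
  obtain a b c where x: "x = (of_int a + of_int b * w) / of_int c" "odd c"
    using assms unfolding O_ring_def by blast
  obtain u where u: "d = 2 * u" "odd u" by (rule d_half)
  have [simp]: "c \<noteq> 0" "u \<noteq> 0" using x u by auto
  show ?thesis
  proof (cases "even a")
    case True
    then obtain a' where a': "a = 2 * a'" by (auto elim: evenE)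
    \<comment> \<open>Since \<open>a = 2 * a'\<close> and \<open>d = 2 * u\<close>, multiplying by
      the odd \<open>u\<close> turns \<open>a\<close> into \<open>a' * d = a' * w ^ 2\<close>, from
      which \<open>w\<close> can be factored out.\<close>
    have "of_int u * x * of_int c = of_int a' * of_int d + of_int u * of_int b * w"
      unfolding x a' by (simp add: field_simps u)
    also have "\<dots> = w * (of_int a' * w + of_int u * of_int b)"
      using w_sq(1) by (simp add: algebra_simps)
    finally have "x / w = (of_int (u * b) + of_int a' * w) / of_int (u * c)"
      by (simp add: field_simps)
    moreover have "odd (u * c)" using u x by simp
    ultimately show ?thesis by (blast intro: O_intI)
  next
    case False
    have "even d" using d_mod by presburger
    then have o: "odd (a ^ 2 - d * b ^ 2)" using False by simp
    have nz: "a ^ 2 - d * b ^ 2 \<noteq> 0" using o by (metis even_zero)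
    have "(of_int a + of_int b * w) * (of_int a - of_int b * w) = (of_int a)^2 - (w * w) * (of_int b)^2"
      by (simp add: algebra_simps power2_eq_square)
    then have pr: "(of_int a + of_int b * w) * (of_int a - of_int b * w) = of_int (a ^ 2 - d * b ^ 2)"
      by (simp add: w_sq)
    then have nz2: "of_int a + of_int b * w \<noteq> 0" 
      using nz by (metis mult_zero_left of_int_eq_0_iff)
    have "1 / x = of_int c / (of_int a + of_int b * w)" unfolding x by simp
    also have "\<dots> = of_int c * (of_int a - of_int b * w) / of_int (a ^ 2 - d * b ^ 2)"
      unfolding pr[symmetric] using nz2 pr nz 
      by (metis (no_types, lifting) mult_divide_mult_cancel_right mult_zero_right of_int_eq_0_iff)
    also have "\<dots> = (of_int (c * a) + of_int (- c * b) * w) / of_int (a ^ 2 - d * b ^ 2)"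
      by (simp add: algebra_simps)
    finally have "1 / x \<in> O_ring" using o by (rule O_intI)
    moreover have "x \<noteq> 0" using nz2 x by simp
    ultimately show ?thesis by blast
  qed
qed

section \<open>Calculus of the ideals \<open>J k\<close> and of exact valuations\<close>

lemma J_0: "J 0 = O_ring" by (simp add: J_def)

lemma J_add: "x \<in> J k \<Longrightarrow> y \<in> J k \<Longrightarrow> x + y \<in> J k"
  unfolding J_def by (simp add: add_divide_distrib O_add)

lemma J_uminus: "x \<in> J k \<Longrightarrow> - x \<in> J k"
  using O_uminus unfolding J_def by fastforce

lemma J_diff: "x \<in> J k \<Longrightarrow> y \<in> J k \<Longrightarrow> x - y \<in> J k"
  using J_add[of x k "- y"] J_uminus[of y k] by simp

lemma J_diff_commute: "x - y \<in> J k \<longleftrightarrow> y - x \<in> J k"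
  using J_uminus[of "x - y" k] J_uminus[of "y - x" k] by auto

lemma J_zero [simp]: "0 \<in> J k" by (simp add: J_def)

lemma J_mult: "x \<in> J k \<Longrightarrow> y \<in> J l \<Longrightarrow> x * y \<in> J (k + l)"
  unfolding J_def using O_mult[of "x / w powi k" "y / w powi l"]
  by (simp add: power_int_add)

lemma J_power: "x \<in> J k \<Longrightarrow> x ^ n \<in> J (int n * k)"
proof (induction n)
  case (Suc n)
  then show ?case using J_mult[of x k "x ^ n" "int n * k"] by (simp add: algebra_simps)
qed (simp add: J_0)

lemma J_mono: assumes "k \<le> l" "x \<in> J l" shows "x \<in> J k"
proof -
  have "x / w powi k = x / w powi l * w powi (l - k)"
    by (simp add: power_int_diff)
  then show ?thesis using assms O_mult[OF _ O_w_power[of "l - k"], of "x / w powi l"]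
    by (simp add: J_def)
qed

lemma J_sum: "(\<And>i. i \<in> A \<Longrightarrow> f i \<in> J k) \<Longrightarrow> sum f A \<in> J k"
  by (induction A rule: infinite_finite_induct) (auto intro: J_add)

lemma J_powi_mult: "w powi k * x \<in> J l \<longleftrightarrow> x \<in> J (l - k)"
proof -
  have "w powi k * x / w powi l = x / w powi (l - k)" by (simp add: power_int_diff)
  then show ?thesis by (simp add: J_def)
qed

lemma E_powi_mult: "w powi k * x \<in> E l \<longleftrightarrow> x \<in> E (l - k)"
  by (simp add: E_def J_powi_mult diff_add_eq)

lemma E_J: "x \<in> E k \<Longrightarrow> l \<le> k \<Longrightarrow> x \<in> J l"
  unfolding E_def using J_mono by blast

lemma E_not_J: "x \<in> E k \<Longrightarrow> k < l \<Longrightarrow> x \<notin> J l"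
  unfolding E_def using J_mono[of "k + 1" l x] by auto

lemma E_J_iff: "x \<in> E k \<Longrightarrow> x \<in> J l \<longleftrightarrow> l \<le> k"
  using E_J[of x k l] E_not_J[of x k l] by linarith

lemma E_unique: "x \<in> E k \<Longrightarrow> x \<in> E l \<Longrightarrow> k = l"
  using E_not_J[of x k l] E_not_J[of x l k] E_J[of x k k] E_J[of x l l] by linarith

lemma E_nz: "x \<in> E k \<Longrightarrow> x \<noteq> 0"
  unfolding E_def by auto

text \<open>Units are closed under products and inverses, so in this form multiplicativity of exact
  valuations follows after scaling by powers of \<open>w\<close>.\<close>

lemma E0_iff: "x \<in> E 0 \<longleftrightarrow> x \<in> O_ring \<and> x \<noteq> 0 \<and> 1 / x \<in> O_ring"
proof
  assume "x \<in> E 0"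
  then show "x \<in> O_ring \<and> x \<noteq> 0 \<and> 1 / x \<in> O_ring"
    using O_cases[of x] by (auto simp: E_def J_def)
next
  assume *: "x \<in> O_ring \<and> x \<noteq> 0 \<and> 1 / x \<in> O_ring"
  have "x / w \<notin> O_ring"
  proof
    assume "x / w \<in> O_ring"
    then have "(x / w) * (1 / x) \<in> O_ring" using * O_mult by blast
    then show False using one_div_w * by simp
  qed
  then show "x \<in> E 0" using * by (simp add: E_def J_def)
qed

lemma E_iff: "x \<in> E k \<longleftrightarrow> x / w powi k \<in> E 0"
  using E_powi_mult[of k "x / w powi k" k] by simp

lemma E_mult: assumes "x \<in> E k" "y \<in> E l" shows "x * y \<in> E (k + l)"
proof -
  have "x / w powi k * (y / w powi l) \<in> E 0"
    using assms O_mult[of "x / w powi k" "y / w powi l"] O_mult[of "1 / (x / w powi k)" "1 / (y / w powi l)"] 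
    unfolding E_iff[of _ k] E_iff[of _ l] E0_iff by simp
  then show ?thesis unfolding E_iff[of _ "k + l"] by (simp add: power_int_add)
qed

lemma E_inverse: assumes "x \<in> E k" shows "1 / x \<in> E (- k)"
  using assms unfolding E_iff[of _ k] E_iff[of _ "- k"] E0_iff by (simp add: power_int_minus field_simps)

lemma E_power: "x \<in> E k \<Longrightarrow> x ^ n \<in> E (int n * k)"
proof (induction n)
  case 0 show ?case by (simp add: E0_iff)
next
  case (Suc n)
  then show ?case using E_mult[of x k "x ^ n" "int n * k"] by (simp add: algebra_simps)
qed

lemma E_divide: "x \<in> E k \<Longrightarrow> y \<in> E l \<Longrightarrow> x / y \<in> E (k - l)"
  using E_mult[of x k "1 / y" "- l"] E_inverse[of y l] by simp

lemma J_divide: "x \<in> J k \<Longrightarrow> y \<in> E l \<Longrightarrow> x / y \<in> J (k - l)"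
  using J_mult[of x k "1 / y" "- l"] E_J[OF E_inverse[of y l]] by simp

lemma E_J_mult_iff: "y \<in> E l \<Longrightarrow> x * y \<in> J (k + l) \<longleftrightarrow> x \<in> J k"
  using J_divide[of "x * y" "k + l" y l] J_mult[of x k y l] E_J[of y l l] E_nz[of y l] by auto

lemma E_powi: "w powi k \<in> E k"
  using E_powi_mult[of k 1 k] by (simp add: E0_iff)

lemma E_w: "w \<in> E 1" using E_powi[of 1] by simp

lemma E_uminus: "x \<in> E k \<Longrightarrow> - x \<in> E k"
  unfolding E_def using J_uminus[of "- x" "k + 1"] by (auto intro: J_uminus)

lemma E_add_J: "x \<in> E k \<Longrightarrow> y \<in> J (k + 1) \<Longrightarrow> x + y \<in> E k"
  unfolding E_def using J_diff[of "x + y" "k + 1" y] J_add[of x k y] J_mono[of k "k + 1" y] by auto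

lemma E_odd: "odd a \<Longrightarrow> of_int a \<in> E 0"
  unfolding E0_iff using O_inv_odd by auto

text \<open>The prime 2 ramifies: \<open>2 = w ^ 2 / u\<close>, where \<open>u = d / 2\<close> is
  odd and hence a unit.\<close>

lemma E_2: "2 \<in> E 2"
proof -
  obtain u where u: "d = 2 * u" "odd u" by (rule d_half)
  have "w ^ 2 = 2 * of_int u"
    using w_sq(2) arg_cong[OF u(1), of complex_of_int] by simp
  moreover have "of_int u \<noteq> (0 :: complex)" using u(2) by auto
  ultimately have "2 = w ^ 2 / of_int u" by simp
  also have "\<dots> \<in> E (2 - 0)" using E_divide[OF E_powi[of 2] E_odd[OF u(2)]] by simp
  finally show ?thesis by simp
qed

lemma E_4: "4 \<in> E 4" using E_mult[OF E_2 E_2] by simp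

lemma J_even: "even a \<Longrightarrow> of_int a \<in> J 1"
  using J_mult[OF E_J[OF E_2, of 1], of _ 0] by (auto elim!: evenE simp: J_0)

text \<open>The residue field has two elements.\<close>

lemma E_add: assumes "x \<in> E k" "y \<in> E k" shows "x + y \<in> J (k + 1)"
proof -
  \<comment> \<open>This is the case \<open>y = 1\<close>: a unit has odd \<open>a\<close> and odd
    denominator \<open>c\<close>, so \<open>a + c\<close> is even. The general case follows on
    dividing by \<open>y\<close>.\<close>
  have *: "x + 1 \<in> J 1" if xE: "x \<in> E 0" for x
  proof -
    obtain a b c where x: "x = (of_int a + of_int b * w) / of_int c" "odd c"
      using xE unfolding E0_iff O_ring_def by blast
    have c: "of_int c \<in> E 0" using x by (intro E_odd)
    have "odd a"
    proof
      assume "even a"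
      have "of_int a + of_int b * w \<in> J 1"
        using J_even[OF \<open>even a\<close>] J_mult[of "of_int b" 0 w 1] E_J[OF E_w, of 1] by (auto intro: J_add simp: J_0)
      then have "x \<in> J 1" unfolding x using J_divide[OF _ c, of _ 1] by simp
      then show False using xE by (simp add: E_def)
    qed
    then have "of_int (a + c) + of_int b * w \<in> J 1"
      using J_even[of "a + c"] J_mult[of "of_int b" 0 w 1] E_J[OF E_w, of 1] x(2)
      by (intro J_add) (auto simp: J_0)
    then have "(of_int (a + c) + of_int b * w) / of_int c \<in> J 1"
       using J_divide[OF _ c, of _ 1] by simp
    moreover have "(of_int (a + c) + of_int b * w) / of_int c = x + 1"
    proof -
      have "c \<noteq> 0" using x(2) by auto
      then show ?thesis unfolding x(1) by (simp add: field_simps)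
    qed
    ultimately show ?thesis by simp
  qed
  have "x / y \<in> E 0" using E_divide[OF assms] by simp
  then have "(x / y + 1) * y \<in> J (1 + k)" using J_mult[OF * E_J[OF assms(2)]] by simp
  moreover have "(x / y + 1) * y = x + y" using E_nz[OF assms(2)] by (simp add: distrib_right)
  ultimately show ?thesis by (simp add: add.commute)
qed

lemma J_cases: "x \<in> J k \<Longrightarrow> x \<in> E k \<or> x \<in> J (k + 1)"
  by (auto simp: E_def)

section \<open>Fourth roots and the embedding of the number field\<close>

text \<open>The part \<open>4 * w * (1 + d)\<close> has valuation exactly 5. The rest is
  \<open>6 * d + d ^ 2 = 4 * u * (3 + u)\<close> with \<open>u\<close> odd, hence divisible by 8 and
  of valuation at least 6.\<close>

lemma eps_E: "(1 + w) ^ 4 - 1 \<in> E 5"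
proof -
  obtain u where u: "d = 2 * u" "odd u" by (rule d_half)
  have "even (u * (3 + u))" using u(2) by simp
  then obtain m where m: "u * (3 + u) = 2 * m" by (rule evenE)
  have d8: "6 * d + d ^ 2 = 8 * m"
  proof -
    have "6 * d + d ^ 2 = 4 * (u * (3 + u))" using u(1) by (simp add: algebra_simps power2_eq_square)
    then show ?thesis using m by simp
  qed
  have "(1 + w) ^ 4 - 1 = 4 * w * (1 + w\<^sup>2) + (6 * w\<^sup>2 + (w\<^sup>2)\<^sup>2)"
    by (simp add: algebra_simps power4_eq_xxxx power2_eq_square)
  also have "\<dots> = 4 * w * of_int (1 + d) + of_int (6 * d + d ^ 2)"
    by (simp add: w_sq)
  also have "of_int (6 * d + d ^ 2) = (4 * 2 * of_int m :: complex)"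
    unfolding d8 by simp
  finally have *: "(1 + w) ^ 4 - 1 = 4 * w * of_int (1 + d) + 4 * 2 * of_int m" .
  have "even d" using d_mod by presburger
  then have "4 * w * of_int (1 + d) \<in> E (4 + 1 + 0)"
    by (intro E_mult E_4 E_w E_odd) auto
  moreover have "4 * 2 * of_int m \<in> J (4 + 2 + 0)"
    using E_J[OF E_4, of 4] E_J[OF E_2, of 2] by (intro J_mult) (auto simp: J_0)
  ultimately show ?thesis unfolding * using E_add_J[of _ 5] by simp
qed

lemma J_1_E0: "x - 1 \<in> J k \<Longrightarrow> k > 0 \<Longrightarrow> x \<in> E 0"
  using E_add_J[of 1 0 "x - 1"] J_mono[of 1 k "x - 1"] by (simp add: E0_iff)

text \<open>Newton iteration started at 1. Dividing by the derivative \<open>4 * y ^ 3\<close> costs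
  four powers of \<open>w\<close>, so the correction \<open>e\<close> lies in
  \<open>J (3 + n)\<close>; the new error is \<open>e ^ 2\<close> times an element of
  \<open>J 2\<close>, hence lies in \<open>J (8 + 2 * n)\<close>.\<close>

lemma quartic_root_approx:
  assumes "t - 1 \<in> J 7"
  shows "\<exists>y. y - 1 \<in> J 3 \<and> y ^ 4 - t \<in> J (7 + int n)"
proof (induction n)
  case 0
  show ?case using assms by (intro exI[of _ 1]) (simp add: J_diff_commute)
next
  case (Suc n)
  then obtain y where y: "y - 1 \<in> J 3" "y ^ 4 - t \<in> J (7 + int n)" by blast
  have yE: "y \<in> E 0" using J_1_E0[OF y(1)] by simp
  define e where "e = (t - y ^ 4) / (4 * y ^ 3)"
  have "4 * y ^ 3 \<in> E (4 + int 3 * 0)" by (intro E_mult E_4 E_power yE)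
  then have e: "e \<in> J (3 + int n)"
    unfolding e_def using J_divide[of "t - y ^ 4" "7 + int n" "4 * y ^ 3" 4] y(2) by (simp add: J_diff_commute)
  have nz: "y \<noteq> 0" using E_nz[OF yE] .
  have "4 * y ^ 3 * e = t - y ^ 4" unfolding e_def using nz by simp
  then have "(y + e) ^ 4 - t = e ^ 2 * (2 * 3 * y ^ 2 + 4 * (y * e) + e ^ 2)"
    by (simp add: algebra_simps power2_eq_square power3_eq_cube power4_eq_xxxx)
  moreover have "e ^ 2 * (2 * 3 * y ^ 2 + 4 * (y * e) + e ^ 2) \<in> J (int 2 * (3 + int n) + 2)"
  proof (intro J_mult J_add J_power e)
    have "2 * 3 * y ^ 2 \<in> J (2 + 0 + int 2 * 0)"
      using E_J[OF E_2, of 2] E_J[OF yE, of 0] by (intro J_mult J_power) (auto simp: J_0)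
    then show "2 * 3 * y ^ 2 \<in> J 2" by simp
    have "4 * (y * e) \<in> J (4 + (0 + (3 + int n)))"
      using E_J[OF E_4, of 4] E_J[OF yE, of 0] by (intro J_mult e) auto
    then show "4 * (y * e) \<in> J 2" by (rule J_mono[rotated]) simp
    show "e ^ 2 \<in> J 2" using J_power[OF e, of 2] by (rule J_mono[rotated]) simp
  qed
  ultimately have "(y + e) ^ 4 - t \<in> J (7 + int (Suc n))"
    using J_mono[of "7 + int (Suc n)" "int 2 * (3 + int n) + 2" "(y + e) ^ 4 - t"] by simp
  moreover have "y + e - 1 \<in> J 3"
    using J_add[OF y(1) J_mono[OF _ e, of 3]] by (simp add: algebra_simps)
  ultimately show ?case by blast
qed

text \<open>Both \<open>y + y'\<close> and \<open>y\<^sup>2 + y'\<^sup>2\<close> are \<open>2\<close> times a unit, so they cost four powers of \<open>w\<close> in total.\<close>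

lemma quartic_root_unique:
  assumes "y - 1 \<in> J 3" "y' - 1 \<in> J 3" "y ^ 4 - y' ^ 4 \<in> J (k + 4)"
  shows "y - y' \<in> J k"
proof -
  have y: "y \<in> E 0" "y' \<in> E 0" using J_1_E0 assms by auto
  have dy: "y - y' \<in> J 3" using J_diff[OF assms(1,2)] by simp
  have *: "2 * z + h \<in> E 2" if "z \<in> E 0" "h \<in> J 3" for z h
    using E_add_J[of "2 * z" 2 h] E_mult[OF E_2 that(1)] that(2) by simp
  have "y + y' \<in> E 2" using *[OF y(2) dy] by (simp add: algebra_simps)
  moreover have "y ^ 2 + y' ^ 2 \<in> E 2"
  proof -
    have "(y - y') * (y + y') \<in> J (3 + 0)"
      using E_J[OF y(1), of 0] E_J[OF y(2), of 0] by (intro J_mult dy J_add) auto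
    then have "2 * y' ^ 2 + (y - y') * (y + y') \<in> E 2"
      using E_power[OF y(2), of 2] by (intro *) auto
    then show ?thesis by (simp add: algebra_simps power2_eq_square)
  qed
  ultimately have "(y + y') * (y ^ 2 + y' ^ 2) \<in> E (2 + 2)" by (rule E_mult)
  moreover have "(y - y') * ((y + y') * (y ^ 2 + y' ^ 2)) = y ^ 4 - y' ^ 4"
    by (simp add: algebra_simps power2_eq_square power4_eq_xxxx)
  ultimately show ?thesis
    using E_J_mult_iff[of "(y + y') * (y ^ 2 + y' ^ 2)" 4 "y - y'" k] assms(3) by simp
qed

section \<open>The 2-adic valuation of rationals and coordinates with respect to 1 and
  \<open>w\<close>\<close>

lemma int_E:
  assumes "a \<noteq> 0"
  shows "of_int a \<in> E (2 * int (multiplicity (2 :: int) a))"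
proof -
  obtain b where b: "a = 2 ^ multiplicity (2 :: int) a * b" "\<not> 2 dvd b"
    using multiplicity_decompose'[of a 2] assms by auto
  have "of_int a = (2 :: complex) ^ multiplicity 2 a * of_int b"
    by (subst b(1)) simp
  also have "\<dots> \<in> E (int (multiplicity 2 a) * 2 + 0)"
    using b(2) by (intro E_mult E_power E_2 E_odd) auto
  finally show ?thesis by (simp add: mult.commute)
qed

lemma rat_E:
  assumes "r \<noteq> 0"
  shows "of_rat r \<in> E (2 * val2 r)"
proof -
  obtain a b where q: "quotient_of r = (a, b)" by (cases "quotient_of r")
  have r: "r = of_int a / of_int b" "b > 0" using quotient_of_div[OF q] quotient_of_denom_pos[OF q] by auto
  have "a \<noteq> 0" "b \<noteq> 0" using r assms by auto
  then have "of_int a / of_int b \<in> E (2 * int (multiplicity (2::int) a) - 2 * int (multiplicity (2::int) b))"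
    by (intro E_divide int_E)
  then show ?thesis unfolding val2_def q by (simp add: r of_rat_divide algebra_simps)
qed

lemma small2_iff: "small2 k r \<longleftrightarrow> of_rat r \<in> J (2 * k)"
proof (cases "r = 0")
  case False
  then show ?thesis using E_J_iff[OF rat_E[OF False], of "2 * k"] by (simp add: small2_def)
qed (simp add: small2_def)

definition emb :: "rat \<times> rat \<Rightarrow> complex" where
  "emb x = of_rat (fst x) + of_rat (snd x) * w"

text \<open>The summands \<open>r\<close> and \<open>s * w\<close> have valuations of opposite
  parity, \<open>2 * val2 r\<close> and \<open>2 * val2 s + 1\<close>. They cannot cancel, so the
  sum has the smaller of the two valuations.\<close>

lemma emb_E: "x \<noteq> (0, 0) \<Longrightarrow> \<exists>k. emb x \<in> E k"
  and emb_J: "emb x \<in> J (2 * k) \<longleftrightarrow> small2 k (fst x) \<and> small2 k (snd x)"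
proof -
  obtain r s where x: "x = (r, s)" by (cases x)
  have E1: "of_rat r \<in> E (2 * val2 r)" if "r \<noteq> 0" using rat_E[OF that] .
  have E2: "of_rat s * w \<in> E (2 * val2 s + 1)" if "s \<noteq> 0" using E_mult[OF rat_E[OF that] E_w] .
  consider "r = 0" "s = 0" | "r = 0" "s \<noteq> 0" | "r \<noteq> 0" "s = 0"
    | "r \<noteq> 0" "s \<noteq> 0" "val2 r \<le> val2 s" | "r \<noteq> 0" "s \<noteq> 0" "val2 s < val2 r" by linarith
  then have "(x \<noteq> (0, 0) \<longrightarrow> (\<exists>k. emb x \<in> E k)) \<and>
      (emb x \<in> J (2 * k) \<longleftrightarrow> small2 k (fst x) \<and> small2 k (snd x))"
  proof cases
    case 1
    then show ?thesis by (simp add: x emb_def small2_def)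
  next
    case 2
    then show ?thesis using E2 E_J_iff[OF E2, of "2 * k"]
      by (auto simp: x emb_def small2_def)
  next
    case 3
    then show ?thesis using E1 E_J_iff[OF E1, of "2 * k"]
      by (auto simp: x emb_def small2_def)
  next
    case 4
    then have "emb x \<in> E (2 * val2 r)"
      using E_add_J[OF E1 E_J[OF E2]] by (simp add: x emb_def)
    then show ?thesis using 4 E_J_iff[of "emb x" "2 * val2 r" "2 * k"]
      by (auto simp: x small2_def)
  next
    case 5
    then have *: "emb x \<in> E (2 * val2 s + 1)"
      using E_add_J[OF E2 E_J[OF E1]] by (simp add: x emb_def add.commute)
    then show ?thesis using 5 E_J_iff[of "emb x" "2 * val2 s + 1" "2 * k"]
      by (auto simp: x small2_def)
  qed
  then show "x \<noteq> (0, 0) \<Longrightarrow> \<exists>k. emb x \<in> E k"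
    "emb x \<in> J (2 * k) \<longleftrightarrow> small2 k (fst x) \<and> small2 k (snd x)" by auto
qed

lemma emb_diff: "emb x - emb y = emb (fst x - fst y, snd x - snd y)"
  by (simp add: emb_def of_rat_diff algebra_simps)

lemma emb_qmul: "emb (qmul d x y) = emb x * emb y"
proof -
  have "emb x * emb y = of_rat (fst x) * of_rat (fst y) + of_rat (snd x) * of_rat (snd y) * (w * w)
     + (of_rat (fst x) * of_rat (snd y) + of_rat (snd x) * of_rat (fst y)) * w"
    by (simp add: emb_def algebra_simps)
  then show ?thesis
    by (simp add: w_sq emb_def qmul_def of_rat_add of_rat_mult algebra_simps)
qed

lemma emb_qpow: "emb (qpow d x n) = emb x ^ n"
  by (induction n) (simp_all add: emb_qmul, simp add: emb_def)

lemma emb_diag_form: "emb (diag_form d e s a x n) = (\<Sum>i<s. emb (a i n) * emb (x i n) ^ e)"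
proof -
  have *: "emb ((\<Sum>i<m. fst (f i)), (\<Sum>i<m. snd (f i))) = (\<Sum>i<m. emb (f i))" for f :: "nat \<Rightarrow> rat \<times> rat" and m :: nat
    by (induction m) (simp_all add: emb_def of_rat_add algebra_simps)
  from *[of "\<lambda>i. qmul d (a i n) (qpow d (x i n) e)" s] show ?thesis
    by (simp add: diag_form_def emb_qmul emb_qpow)
qed

lemma F_emb: "F = range emb"
proof
  show "F \<subseteq> range emb"
  proof
    fix x assume "x \<in> F"
    then obtain a b c where "x = (of_int a + of_int b * w) / of_int c" unfolding F_def by blast
    then have "x = emb (of_int a / of_int c, of_int b / of_int c)"
      by (simp add: emb_def of_rat_divide add_divide_distrib)
    then show "x \<in> range emb" by blast
  qed
  show "range emb \<subseteq> F"
  proof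
    fix x assume "x \<in> range emb"
    then obtain r s where x: "x = emb (r, s)" by auto
    obtain a b where r: "r = of_int a / of_int b" "b > 0"
      using quotient_of_div[of r] quotient_of_denom_pos[of r] by (cases "quotient_of r") auto
    obtain a' b' where s: "s = of_int a' / of_int b'" "b' > 0"
      using quotient_of_div[of s] quotient_of_denom_pos[of s] by (cases "quotient_of s") auto
    have "x = (of_int (a * b') + of_int (a' * b) * w) / of_int (b * b')"
      unfolding x r(1) s(1) using r(2) s(2) by (simp add: emb_def of_rat_divide field_simps)
    moreover have "b * b' \<noteq> 0" using r s by auto
    ultimately show "x \<in> F" unfolding F_def by blast
  qed
qed

lemma F_mult: "x \<in> F \<Longrightarrow> y \<in> F \<Longrightarrow> x * y \<in> F"
  unfolding F_emb by (auto simp flip: emb_qmul)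

lemma O_F: "x \<in> O_ring \<Longrightarrow> x \<in> F"
proof -
  assume "x \<in> O_ring"
  then obtain a b c where *: "x = (of_int a + of_int b * w) / of_int c" "odd c" unfolding O_ring_def by blast
  then have "c \<noteq> 0" by auto
  then show ?thesis unfolding F_def using * by blast
qed

lemma J_F: "x \<in> J k \<Longrightarrow> x \<in> F"
proof -
  assume x: "x \<in> J k"
  have "w powi m \<in> F" for m
  proof (cases "m \<ge> 0")
    case True
    then show ?thesis by (intro O_F O_w_power)
  next
    case False
    have "1 / w = emb (0, 1 / of_int d)"
      using w_sq(1) d_nz by (simp add: emb_def of_rat_divide field_simps)
    then have "1 / w \<in> F" unfolding F_emb by blast
    have "(1 / w) ^ n \<in> F" for n
    proof (induction n)
      case (Suc n)
      show ?case using F_mult[OF \<open>1 / w \<in> F\<close> Suc] by simp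
    qed (simp add: O_F)
    from this[of "nat (- m)"] show ?thesis using False by (simp add: power_int_def divide_inverse)
  qed
  then have "w powi k * (x / w powi k) \<in> F" using x O_F unfolding J_def by (intro F_mult) auto
  then show ?thesis by simp
qed

lemma F_E: "x \<in> F \<Longrightarrow> x \<noteq> 0 \<Longrightarrow> \<exists>k. x \<in> E k"
proof -
  assume "x \<in> F" "x \<noteq> 0"
  then obtain p where "x = emb p" unfolding F_emb by blast
  moreover have "p \<noteq> (0, 0)" using \<open>x \<noteq> 0\<close> calculation by (auto simp: emb_def)
  ultimately show ?thesis using emb_E by blast
qed

section \<open>Cauchy and null sequences for the \<open>w\<close>-adic valuation\<close>

definition cauchy :: "(nat \<Rightarrow> complex) \<Rightarrow> bool" where
  "cauchy X \<longleftrightarrow> (\<forall>k. \<exists>N. \<forall>m\<ge>N. \<forall>n\<ge>N. X m - X n \<in> J k)"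

definition null :: "(nat \<Rightarrow> complex) \<Rightarrow> bool" where
  "null X \<longleftrightarrow> (\<forall>k. \<exists>N. \<forall>n\<ge>N. X n \<in> J k)"

text \<open>\<open>emb_J\<close> speaks only of ideals of even index; this passes from them to an
  arbitrary index of either sign.\<close>

lemma J_le_twice: "x \<in> J (2 * \<bar>k\<bar>) \<Longrightarrow> x \<in> J k"
  by (rule J_mono[rotated]) auto

lemma is_K_elem_iff: "is_K_elem X \<longleftrightarrow> cauchy (\<lambda>n. emb (X n))"
proof
  assume X: "is_K_elem X"
  show "cauchy (\<lambda>n. emb (X n))" unfolding cauchy_def
  proof
    fix k
    obtain N1 where N1: "\<forall>m\<ge>N1. \<forall>n\<ge>N1. small2 \<bar>k\<bar> (fst (X m) - fst (X n))"
      using X unfolding is_K_elem_def cauchy2_def by blast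
    obtain N2 where N2: "\<forall>m\<ge>N2. \<forall>n\<ge>N2. small2 \<bar>k\<bar> (snd (X m) - snd (X n))"
      using X unfolding is_K_elem_def cauchy2_def by blast
    have "emb (X m) - emb (X n) \<in> J (2 * \<bar>k\<bar>)" if "m \<ge> max N1 N2" "n \<ge> max N1 N2" for m n
      using N1 N2 that by (simp add: emb_diff emb_J)
    then show "\<exists>N. \<forall>m\<ge>N. \<forall>n\<ge>N. emb (X m) - emb (X n) \<in> J k"
      using J_le_twice by blast
  qed
next
  assume X: "cauchy (\<lambda>n. emb (X n))"
  have "\<exists>N. \<forall>m\<ge>N. \<forall>n\<ge>N. small2 k (fst (X m) - fst (X n)) \<and> small2 k (snd (X m) - snd (X n))" for k
    using X[unfolded cauchy_def, rule_format, of "2 * k"] by (simp add: emb_diff emb_J)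
  then show "is_K_elem X" unfolding is_K_elem_def cauchy2_def by meson
qed

lemma is_K_zero_iff: "is_K_zero X \<longleftrightarrow> null (\<lambda>n. emb (X n))"
proof
  assume X: "is_K_zero X"
  show "null (\<lambda>n. emb (X n))" unfolding null_def
  proof
    fix k
    obtain N1 where N1: "\<forall>n\<ge>N1. small2 \<bar>k\<bar> (fst (X n))"
      using X unfolding is_K_zero_def null2_def by blast
    obtain N2 where N2: "\<forall>n\<ge>N2. small2 \<bar>k\<bar> (snd (X n))"
      using X unfolding is_K_zero_def null2_def by blast
    have "emb (X n) \<in> J (2 * \<bar>k\<bar>)" if "n \<ge> max N1 N2" for n
      using N1 N2 that by (simp add: emb_J)
    then show "\<exists>N. \<forall>n\<ge>N. emb (X n) \<in> J k"
      using J_le_twice by blast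
  qed
next
  assume X: "null (\<lambda>n. emb (X n))"
  have "\<exists>N. \<forall>n\<ge>N. small2 k (fst (X n)) \<and> small2 k (snd (X n))" for k
    using X[unfolded null_def, rule_format, of "2 * k"] by (simp add: emb_J)
  then show "is_K_zero X" unfolding is_K_zero_def null2_def by meson
qed

section \<open>Lifting approximate zeros\<close>

lemma cauchy_const: "cauchy (\<lambda>n. c)" by (simp add: cauchy_def)

text \<open>Infinitely many terms stay outside some \<open>J k\<close>. One of them, taken late
  enough, has a valuation \<open>v < k\<close>, and all later terms are so close to it that they
  share this valuation.\<close>

lemma cauchy_leading_term:
  assumes "\<And>n. X n \<in> F" "cauchy X" "\<not> null X" "K > 0"
  shows "\<exists>v N. \<forall>n\<ge>N. X n \<in> E v \<and> (\<forall>m\<ge>N. X n - X m \<in> J (v + K))"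
proof -
  obtain k where k: "\<And>N. \<exists>n\<ge>N. X n \<notin> J k"
    using assms(3) unfolding null_def by blast
  \<comment> \<open>The valuation \<open>v\<close> is found only after \<open>N\<close>. As it will
    be below \<open>k\<close>, precision \<open>k + K\<close> suffices for \<open>v + K\<close> and,
    because \<open>K > 0\<close>, for \<open>v + 1\<close>.\<close>
  obtain N where N: "\<And>m n. m \<ge> N \<Longrightarrow> n \<ge> N \<Longrightarrow> X m - X n \<in> J (k + K)"
    using assms(2) unfolding cauchy_def by meson
  obtain n0 where n0: "n0 \<ge> N" "X n0 \<notin> J k" using k by blast
  then have "X n0 \<noteq> 0" by auto
  then obtain v where v: "X n0 \<in> E v" using F_E assms(1) by blast
  then have vk: "v < k" using n0(2) E_J[of "X n0" v k] by linarith
  have "X n \<in> E v \<and> (\<forall>m\<ge>N. X n - X m \<in> J (v + K))" if "n \<ge> N" for n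
  proof
    have "X n - X n0 \<in> J (v + 1)" using N[OF that n0(1)] by (rule J_mono[rotated]) (use vk assms(4) in auto)
    then show "X n \<in> E v" using E_add_J[OF v] by fastforce
    show "\<forall>m\<ge>N. X n - X m \<in> J (v + K)" using N that J_mono[of "v + K" "k + K"] vk by simp
  qed
  then show ?thesis by blast
qed

text \<open>All variables but the \<open>j\<close>-th keep constant values; the \<open>j\<close>-th one absorbs the error by a fourth root.\<close>

lemma lift_approximate_zero:
  fixes A :: "nat \<Rightarrow> nat \<Rightarrow> complex" and X :: "nat \<Rightarrow> complex"
  assumes j: "j < s" and X: "\<And>i. X i \<in> F"
    and cau: "\<And>i. i < s \<Longrightarrow> cauchy (A i)"
    and B: "\<And>n. n \<ge> N \<Longrightarrow> A j n * X j ^ 4 \<in> E \<mu>"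
    and tot: "\<And>n. n \<ge> N \<Longrightarrow> (\<Sum>i<s. A i n * X i ^ 4) \<in> J (\<mu> + 7)"
  shows "\<exists>Y. (\<forall>i n. Y i n \<in> F) \<and> (\<forall>i<s. cauchy (Y i)) \<and> (\<exists>i<s. \<not> null (Y i))
     \<and> null (\<lambda>n. \<Sum>i<s. A i n * Y i n ^ 4)"
proof -
  define T where "T n = (\<Sum>i<s. A i n * X i ^ 4)" for n
  define b where "b n = A j n * X j ^ 4" for n
  have Xj: "X j \<noteq> 0" using E_nz[OF B[OF order_refl]] by auto
  then obtain e where e: "X j \<in> E e" using F_E[OF X] by blast
  have bE: "b n \<in> E \<mu>" if "n \<ge> N" for n using B[OF that] by (simp add: b_def)
  have TJ: "T n \<in> J (\<mu> + 7)" if "n \<ge> N" for n using tot[OF that] by (simp add: T_def)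
  \<comment> \<open>Replacing the term \<open>b n\<close> by \<open>b n * y ^ 4\<close> changes the
    total to \<open>b n * (y ^ 4 - t n)\<close>, so \<open>y\<close> has to be a fourth root of
    \<open>t n\<close>. The default 1 keeps \<open>t n - 1\<close> in \<open>J 7\<close> for every
    \<open>n\<close>.\<close>
  define t where "t n = (if n \<ge> N then 1 - T n / b n else 1)" for n
  have t1: "t n - 1 \<in> J 7" for n
    using J_uminus[OF J_divide[OF TJ[of n] bE[of n]]] by (simp add: t_def)
  have cauchy_term: "cauchy (\<lambda>n. A i n * X i ^ 4)" if iS: "i < s" for i
  proof (cases "X i = 0")
    case False
    then obtain e where e: "X i \<in> E e" using F_E[OF X] by blast
    show ?thesis unfolding cauchy_def
    proof
      fix k
      obtain M where "\<forall>m\<ge>M. \<forall>n\<ge>M. A i m - A i n \<in> J (k - 4 * e)"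
        using cau[OF iS] unfolding cauchy_def by blast
      then have "(A i m - A i n) * X i ^ 4 \<in> J k" if "m \<ge> M" "n \<ge> M" for m n
        using J_mult[of "A i m - A i n" "k - 4 * e" "X i ^ 4" "4 * e"] E_J[OF E_power[OF e, of 4], of "4 * e"] that
        by simp
      then show "\<exists>M. \<forall>m\<ge>M. \<forall>n\<ge>M. A i m * X i ^ 4 - A i n * X i ^ 4 \<in> J k"
        by (auto simp: left_diff_distrib)
    qed
  qed (simp add: cauchy_const)
  have cT: "\<exists>M. \<forall>m\<ge>M. \<forall>n\<ge>M. T m - T n \<in> J k" for k
  proof -
    have "\<forall>i\<in>{..<s}. \<exists>M. \<forall>m\<ge>M. \<forall>n\<ge>M. A i m * X i ^ 4 - A i n * X i ^ 4 \<in> J k"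
      using cauchy_term unfolding cauchy_def by blast
    then obtain M where M: "\<And>i. i < s \<Longrightarrow> \<forall>m\<ge>M i. \<forall>n\<ge>M i. A i m * X i ^ 4 - A i n * X i ^ 4 \<in> J k"
      by (metis lessThan_iff)
    have "T m - T n \<in> J k" if "m \<ge> Max (M ` {..<s})" "n \<ge> Max (M ` {..<s})" for m n
    proof -
      have "M i \<le> m \<and> M i \<le> n" if "i < s" for i
      proof -
        have "M i \<le> Max (M ` {..<s})" using that by (intro Max_ge) auto
        then show ?thesis using \<open>m \<ge> _\<close> \<open>n \<ge> _\<close> by linarith
      qed
      then show ?thesis unfolding T_def sum_subtractf[symmetric] using M by (intro J_sum) auto
    qed
    then show ?thesis by blast
  qed
  have ct: "\<exists>M. \<forall>m\<ge>M. \<forall>n\<ge>M. t m - t n \<in> J k" for k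
  proof -
    obtain M1 where M1: "\<forall>m\<ge>M1. \<forall>n\<ge>M1. T m - T n \<in> J (k + \<mu>)" using cT by blast
    obtain M2 where M2: "\<forall>m\<ge>M2. \<forall>n\<ge>M2. b m - b n \<in> J (k + \<mu>)"
      using cauchy_term[OF j] unfolding cauchy_def b_def by blast
    have "t m - t n \<in> J k" if m: "m \<ge> max N (max M1 M2)" and n: "n \<ge> max N (max M1 M2)" for m n
    proof -
      have nz: "b m \<noteq> 0" "b n \<noteq> 0" using E_nz[OF bE] m n by auto
      have "t m - t n = (T n * (b m - b n) - (T m - T n) * b n) / (b m * b n)"
        using nz m n by (simp add: t_def field_simps)
      moreover have "T n * (b m - b n) - (T m - T n) * b n \<in> J (k + 2 * \<mu>)"
      proof (rule J_diff)
        have "T n * (b m - b n) \<in> J ((\<mu> + 7) + (k + \<mu>))" using TJ M2 m n by (intro J_mult) auto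
        then show "T n * (b m - b n) \<in> J (k + 2 * \<mu>)" by (rule J_mono[rotated]) simp
        have "(T m - T n) * b n \<in> J ((k + \<mu>) + \<mu>)" using E_J[OF bE, of n \<mu>] M1 m n by (intro J_mult) auto
        then show "(T m - T n) * b n \<in> J (k + 2 * \<mu>)" by (simp add: algebra_simps)
      qed
      moreover have "b m * b n \<in> E (\<mu> + \<mu>)" using m n by (intro E_mult bE) auto
      ultimately show ?thesis using J_divide[of _ "k + 2 * \<mu>" "b m * b n" "\<mu> + \<mu>"] by simp
    qed
    then show ?thesis by blast
  qed
  have "\<forall>n. \<exists>y. y - 1 \<in> J 3 \<and> y ^ 4 - t n \<in> J (7 + int n)"
    using quartic_root_approx[OF t1] by blast
  then obtain y where y: "\<And>n. y n - 1 \<in> J 3" "\<And>n. y n ^ 4 - t n \<in> J (7 + int n)" by metis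
  have yE: "y n \<in> E 0" for n using J_1_E0[OF y(1)] by simp
  \<comment> \<open>The roots were chosen independently for each \<open>n\<close>. They form a
    Cauchy sequence because roots near 1 are unique up to a loss of four powers of \<open>w\<close>,
    whence the precision \<open>k + 4\<close>.\<close>
  have cy: "\<exists>M. \<forall>m\<ge>M. \<forall>n\<ge>M. y m - y n \<in> J k" for k
  proof -
    obtain M where M: "\<forall>m\<ge>M. \<forall>n\<ge>M. t m - t n \<in> J (k + 4)" using ct by blast
    have "y m - y n \<in> J k" if m: "m \<ge> max M (nat (k + 4))" and n: "n \<ge> max M (nat (k + 4))" for m n
    proof (rule quartic_root_unique[OF y(1) y(1)])
      have "y m ^ 4 - t m \<in> J (k + 4)" "y n ^ 4 - t n \<in> J (k + 4)"
        using m n by (auto intro: J_mono[OF _ y(2)])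
      moreover have "t m - t n \<in> J (k + 4)" using M m n by auto
      ultimately have "(y m ^ 4 - t m) - (y n ^ 4 - t n) + (t m - t n) \<in> J (k + 4)"
        using J_add[OF J_diff[of "y m ^ 4 - t m" "k + 4" "y n ^ 4 - t n"], of "t m - t n"] by blast
      then show "y m ^ 4 - y n ^ 4 \<in> J (k + 4)" by simp
    qed
    then show ?thesis by blast
  qed
  define Y where "Y i n = (if i = j then X j * y n else X i)" for i n
  have "Y i n \<in> F" for i n
    using X F_mult[OF X J_F[OF E_J[OF yE order_refl]]] by (auto simp: Y_def)
  moreover have "cauchy (Y i)" for i
  proof (cases "i = j")
    case True
    have "\<exists>M. \<forall>m\<ge>M. \<forall>n\<ge>M. X j * y m - X j * y n \<in> J k" for k
    proof -
      obtain M where "\<forall>m\<ge>M. \<forall>n\<ge>M. y m - y n \<in> J (k - e)" using cy by blast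
      then have "X j * (y m - y n) \<in> J k" if "m \<ge> M" "n \<ge> M" for m n
        using J_mult[of "X j" e "y m - y n" "k - e"] E_J[OF e order_refl] that by simp
      then show ?thesis by (auto simp: right_diff_distrib)
    qed
    then show ?thesis using True by (simp add: cauchy_def Y_def)
  next
    case False
    then have "Y i = (\<lambda>n. X i)" by (simp add: Y_def fun_eq_iff)
    then show ?thesis by (simp add: cauchy_const)
  qed
  moreover have "\<not> null (Y j)"
  proof
    assume "null (Y j)"
    then obtain M where "\<forall>n\<ge>M. Y j n \<in> J (e + 1)" unfolding null_def by blast
    moreover have "X j * y M \<in> E (e + 0)" using e yE by (rule E_mult)
    ultimately show False using E_not_J[of "Y j M" e "e + 1"] by (simp add: Y_def)
  qed
  moreover have "null (\<lambda>n. \<Sum>i<s. A i n * Y i n ^ 4)"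
    unfolding null_def
  proof
    fix k
    have "(\<Sum>i<s. A i n * Y i n ^ 4) \<in> J k" if n: "n \<ge> max N (nat (k - \<mu>))" for n
    proof -
      have "(\<Sum>i<s. A i n * Y i n ^ 4) = (\<Sum>i\<in>{..<s} - {j}. A i n * Y i n ^ 4) + A j n * Y j n ^ 4"
        using j by (simp add: sum.remove[of _ j] add.commute)
      also have "(\<Sum>i\<in>{..<s} - {j}. A i n * Y i n ^ 4) = (\<Sum>i\<in>{..<s} - {j}. A i n * X i ^ 4)"
        by (intro sum.cong) (auto simp: Y_def)
      also have "\<dots> = T n - b n" unfolding T_def b_def using j by (simp add: sum.remove[of _ j])
      also have "A j n * Y j n ^ 4 = b n * y n ^ 4" by (simp add: Y_def b_def power_mult_distrib)
      also have "T n - b n + b n * y n ^ 4 = b n * (y n ^ 4 - t n)"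
        using n E_nz[OF bE[of n]] by (simp add: t_def field_simps)
      finally have "(\<Sum>i<s. A i n * Y i n ^ 4) = b n * (y n ^ 4 - t n)" .
      moreover have "b n * (y n ^ 4 - t n) \<in> J (\<mu> + (7 + int n))"
        using n E_J[OF bE, of n \<mu>] y(2) by (intro J_mult) auto
      moreover have "k \<le> \<mu> + (7 + int n)" using n by auto
      ultimately show ?thesis using J_mono[of k "\<mu> + (7 + int n)"] by simp
    qed
    then show "\<exists>M. \<forall>n\<ge>M. (\<Sum>i<s. A i n * Y i n ^ 4) \<in> J k" by blast
  qed
  ultimately show ?thesis using j by blast
qed

section \<open>Correcting the last three digits\<close>

lemma E_add_cases: "x \<in> J k \<Longrightarrow> y \<in> E k \<Longrightarrow> x \<in> J (k + 1) \<or> x + y \<in> J (k + 1)"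
  using J_cases[of x k] E_add[of x k y] by blast

text \<open>Modulo \<open>w ^ 7\<close> every fourth power of an element of \<open>O_ring\<close> is
  the fourth power of one of these four.\<close>

definition digits :: "complex set" where "digits = {0, 1, w, 1 + w}"

text \<open>The term of valuation 0 is the one to be adjusted by a fourth root; this works as soon
  as the total error lies seven digits beyond it.\<close>

definition has_approx_zero :: "nat set \<Rightarrow> (nat \<Rightarrow> complex) \<Rightarrow> bool" where
  "has_approx_zero I B \<longleftrightarrow> (\<exists>x. (\<forall>i. x i \<in> digits) \<and> (\<exists>j\<in>I. B j \<in> E 0 \<and> x j \<in> {1, 1 + w})
     \<and> (\<Sum>i\<in>I. B i * x i ^ 4) \<in> J 7)"

text \<open>The sets \<open>U - T\<close>, \<open>T\<close> and \<open>W\<close> collect the indices with value \<open>1\<close>, \<open>1 + w\<close> and \<open>w\<close>.\<close>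

lemma has_approx_zeroI:
  assumes fin: "finite I" and U: "U \<subseteq> I" "T \<subseteq> U" and W: "W \<subseteq> I - U" and j: "j \<in> U" "B j \<in> E 0"
    and S: "sum B U + ((1 + w) ^ 4 - 1) * sum B T + w ^ 4 * sum B W \<in> J 7"
  shows "has_approx_zero I B"
proof -
  define x where "x i = (if i \<in> T then 1 + w else if i \<in> U then 1 else if i \<in> W then w else 0)" for i
  have fins: "finite U" "finite T" "finite W" using fin U W by (meson finite_subset Diff_subset order_trans)+
  have "(\<Sum>i\<in>I. B i * x i ^ 4)
    = (\<Sum>i\<in>I. (if i \<in> U then B i else 0) + (if i \<in> T then ((1 + w) ^ 4 - 1) * B i else 0) + (if i \<in> W then w ^ 4 * B i else 0))"
    using U W by (intro sum.cong) (auto simp: x_def algebra_simps)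
  also have "\<dots> = sum B U + ((1 + w) ^ 4 - 1) * sum B T + w ^ 4 * sum B W"
  proof -
    have "I \<inter> U = U" "I \<inter> T = T" "I \<inter> W = W" using U W by auto
    then show ?thesis using fin by (simp add: sum.distrib sum.If_cases Int_def[symmetric] sum_distrib_left)
  qed
  finally have "(\<Sum>i\<in>I. B i * x i ^ 4) \<in> J 7" using S by simp
  moreover have "x i \<in> digits" for i by (simp add: x_def digits_def)
  moreover have "x j \<in> {1, 1 + w}" using j by (simp add: x_def)
  ultimately show ?thesis unfolding has_approx_zero_def using j U by blast
qed

lemma level4_digit: "x \<in> E k \<Longrightarrow> w ^ 4 * x \<in> E (4 + k)"
  using E_mult[OF E_powi[of 4], of x k] by simp

lemma level5_digit: "x \<in> E k \<Longrightarrow> ((1 + w) ^ 4 - 1) * x \<in> E (5 + k)"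
  by (rule E_mult[OF eps_E])

text \<open>The digits at \<open>w ^ 4\<close>, \<open>w ^ 5\<close> and \<open>w ^ 6\<close> are
  cleared in turn by optional summands of exactly these valuations: \<open>w ^ 4 * B i\<close>, then
  \<open>e * B j\<close>, then \<open>e * B k\<close> or \<open>w ^ 4 * B k\<close> depending on
  whether \<open>k\<close> lies in \<open>U\<close>. The residue field has two elements, so adding
  the summand or not always suffices.\<close>

lemma approx_zero_mixed_levels:
  assumes fin: "finite I" and U: "U \<subseteq> I" "sum B U \<in> J 4" and j: "j \<in> U" "B j \<in> E 0"
    and i: "i \<in> I - U" "B i \<in> E 0"
    and k: "(k \<in> U \<and> B k \<in> E 1) \<or> (k \<in> I - U \<and> B k \<in> E 2)"
  shows "has_approx_zero I B"
proof -
  define e where "e = (1 + w) ^ 4 - 1"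
  define c where "c = (if k \<in> U then e * B k else w ^ 4 * B k)"
  have c: "c \<in> E 6" using k level4_digit[of "B k" 2] level5_digit[of "B k" 1] by (auto simp: c_def e_def)
  have a: "w ^ 4 * B i \<in> E 4" and b: "e * B j \<in> E 5"
    using level4_digit[OF i(2)] level5_digit[OF j(2)] by (auto simp: e_def)
  have "\<exists>\<alpha> :: bool. sum B U + (if \<alpha> then w ^ 4 * B i else 0) \<in> J 5"
    using E_add_cases[OF U(2) a] by (auto simp: ex_bool_eq)
  then obtain \<alpha> :: bool where \<alpha>: "sum B U + (if \<alpha> then w ^ 4 * B i else 0) \<in> J 5" by blast
  have "\<exists>\<beta> :: bool. sum B U + (if \<alpha> then w ^ 4 * B i else 0) + (if \<beta> then e * B j else 0) \<in> J 6"
    using E_add_cases[OF \<alpha> b] by (auto simp: ex_bool_eq)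
  then obtain \<beta> :: bool where \<beta>: "sum B U + (if \<alpha> then w ^ 4 * B i else 0) + (if \<beta> then e * B j else 0) \<in> J 6"
    by blast
  have "\<exists>\<gamma> :: bool. sum B U + (if \<alpha> then w ^ 4 * B i else 0) + (if \<beta> then e * B j else 0) + (if \<gamma> then c else 0) \<in> J 7"
    using E_add_cases[OF \<beta> c] by (auto simp: ex_bool_eq)
  then obtain \<gamma> :: bool where \<gamma>: "sum B U + (if \<alpha> then w ^ 4 * B i else 0) + (if \<beta> then e * B j else 0)
      + (if \<gamma> then c else 0) \<in> J 7" by blast
  have ne: "k \<noteq> j" "k \<noteq> i" using k i(2) j E_unique[of "B k" 0] by fastforce+
  define T where "T = (if \<beta> then {j} else {}) \<union> (if \<gamma> \<and> k \<in> U then {k} else {})"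
  define W where "W = (if \<alpha> then {i} else {}) \<union> (if \<gamma> \<and> k \<notin> U then {k} else {})"
  have "sum B T = (if \<beta> then B j else 0) + (if \<gamma> \<and> k \<in> U then B k else 0)"
    unfolding T_def using ne by auto
  moreover have "sum B W = (if \<alpha> then B i else 0) + (if \<gamma> \<and> k \<notin> U then B k else 0)"
    unfolding W_def using ne by auto
  ultimately have eqn: "sum B U + e * sum B T + w ^ 4 * sum B W = sum B U + (if \<alpha> then w ^ 4 * B i else 0)
      + (if \<beta> then e * B j else 0) + (if \<gamma> then c else 0)"
    by (simp add: c_def algebra_simps)
  have S: "sum B U + ((1 + w) ^ 4 - 1) * sum B T + w ^ 4 * sum B W \<in> J 7"
    using \<gamma> by (simp only: eqn e_def[symmetric])
  have "T \<subseteq> U" "W \<subseteq> I - U" using j i k by (auto simp: T_def W_def)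
  then show ?thesis by (intro has_approx_zeroI[OF fin U(1) _ _ j S])
qed

text \<open>Some pair sum lies in \<open>J 2\<close>. If it is \<open>x + z\<close> and lies even in
  \<open>J 3\<close>, then \<open>x - z = (x + z) - 2 * z\<close> has valuation exactly 2. Hence,
  after adding \<open>t\<close> to both if necessary, \<open>x + y\<close> and \<open>z + y\<close>
  lie in \<open>J 2\<close> and differ by valuation 2, so one of them has valuation exactly
  2.\<close>

lemma three_units:
  assumes "a \<in> E 0" "b \<in> E 0" "c \<in> E 0" "t \<in> E 1"
  shows "a + b \<in> E 2 \<or> a + c \<in> E 2 \<or> b + c \<in> E 2 \<or> a + b + t \<in> E 2 \<or> a + c + t \<in> E 2 \<or> b + c + t \<in> E 2"
proof -
  have twice: "2 * x \<in> E 2" if "x \<in> E 0" for x using E_mult[OF E_2 that] by simp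
  have J1: "a + b \<in> J 1" "a + c \<in> J 1" "b + c \<in> J 1" using E_add[of _ 0] assms by auto
  have step: ?thesis if "x \<in> E 0" "y \<in> E 0" "z \<in> E 0" "x + z \<in> J 3" "x + y \<in> J 1" and
    sub: "x + y \<in> E 2 \<or> z + y \<in> E 2 \<or> x + y + t \<in> E 2 \<or> z + y + t \<in> E 2 \<Longrightarrow> ?thesis" for x y z
  proof (rule sub)
    have diff: "x - z \<in> E 2"
      using E_add_J[OF E_uminus[OF twice[OF that(3)]], of "x + z"] that(4) by simp
    have *: "u + s \<in> E 2 \<or> u' + s \<in> E 2" if "u + s \<in> J 2" "u - u' \<in> E 2" for u u' s
    proof (rule disjCI)
      assume "u' + s \<notin> E 2"
      have "u' + s = (u + s) - (u - u')" by simp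
      then have "u' + s \<in> J 2" using J_diff[OF that(1) E_J[OF that(2)]] by (simp add: add.commute)
      then have "u' + s \<in> J 3" using J_cases[of "u' + s" 2] \<open>u' + s \<notin> E 2\<close> by simp
      then have "(u - u') + (u' + s) \<in> E 2" using E_add_J[OF that(2), of "u' + s"] by simp
      then show "u + s \<in> E 2" by simp
    qed
    have "(x + y) - (z + y) \<in> E 2" using diff by simp
    moreover have "x + y \<in> J 2 \<or> x + y + t \<in> J 2"
      using E_add_cases[OF that(5) assms(4)] by simp
    ultimately show "x + y \<in> E 2 \<or> z + y \<in> E 2 \<or> x + y + t \<in> E 2 \<or> z + y + t \<in> E 2"
      using *[of "x + y" 0 "z + y"] *[of "x + y" t "z + y"] by auto
  qed
  have pair: "x + y \<in> J 2 \<or> x + z \<in> J 2 \<or> y + z \<in> J 2"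
    if "x \<in> E 0" "y \<in> E 0" "z \<in> E 0" for x y z
  proof (rule ccontr)
    assume *: "\<not> ?thesis"
    have J1: "x + y \<in> J 1" "x + z \<in> J 1" "y + z \<in> J 1" using E_add[of _ 0] that by auto
    then have "x + y \<in> E 1" "x + z \<in> E 1" using * J_cases[of _ 1] by auto
    then have "(x + y) + (x + z) \<in> J 2" using E_add[of "x + y" 1 "x + z"] by simp
    then have "(x + y) + (x + z) - 2 * x \<in> J 2" using E_J[OF twice[OF that(1)], of 2] by (intro J_diff) auto
    then show False using * by (simp add: algebra_simps)
  qed
  have cases: "s \<in> E 2 \<or> s \<in> J 3" if "s \<in> J 2" for s using J_cases[OF that] by simp
  from pair[OF assms(1-3)] consider "a + b \<in> J 3" | "a + c \<in> J 3" | "b + c \<in> J 3" | ?thesis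
    using cases by blast
  then show ?thesis
  proof cases
    case 1
    show ?thesis by (rule step[of a c b]) (use assms 1 J1 in \<open>auto simp: add.commute\<close>)
  next
    case 2
    show ?thesis by (rule step[of a b c]) (use assms 2 J1 in \<open>auto simp: add.commute\<close>)
  next
    case 3
    show ?thesis by (rule step[of b a c]) (use assms 3 J1 in \<open>auto simp: add.commute\<close>)
  qed
qed

text \<open>No coefficient of level 1 or 2 is at hand for the digit at \<open>w ^ 6\<close>. By
  \<open>three_units\<close>, two of the spare units give a correction
  \<open>w ^ 4 * (B x + B y)\<close>, possibly with \<open>e * B j\<close> added, of valuation 6;
  the third unit \<open>z\<close> clears the digit at \<open>w ^ 4\<close>, and
  \<open>e * B j\<close> the one at \<open>w ^ 5\<close>.\<close>

lemma approx_zero_spare_units: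
  assumes fin: "finite I" and U: "U \<subseteq> I" "sum B U \<in> J 4" and j: "j \<in> U" "B j \<in> E 0"
    and ik: "i \<in> I - U" "k \<in> I - U" "l \<in> I - U" "i \<noteq> k" "i \<noteq> l" "k \<noteq> l"
    and E: "B i \<in> E 0" "B k \<in> E 0" "B l \<in> E 0"
  shows "has_approx_zero I B"
proof -
  define e where "e = (1 + w) ^ 4 - 1"
  define t where "t = e * B j / w ^ 4"
  have eB: "e * B j \<in> E 5" using level5_digit[OF j(2)] by (simp add: e_def)
  then have t: "t \<in> E 1" using E_divide[OF eB E_powi[of 4]] by (simp add: t_def)
  have tw: "w ^ 4 * t = e * B j" by (simp add: t_def)
  have main: "has_approx_zero I B"
    if xyz: "x \<in> I - U" "y \<in> I - U" "z \<in> I - U" "x \<noteq> y" "x \<noteq> z" "y \<noteq> z" and Ez: "B z \<in> E 0"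
      and p: "B x + B y \<in> E 2 \<or> B x + B y + t \<in> E 2" for x y z
  proof -
    have fz: "has_approx_zero I B" if "sum B U + e * sum B T + w ^ 4 * sum B W \<in> J 7"
      "T \<subseteq> {j}" "W \<subseteq> {x, y, z}" for T W
      by (rule has_approx_zeroI[where T = T and W = W and B = B and j = j, OF fin U(1) _ _ j]) (use that xyz j e_def in auto)
    have "\<exists>\<alpha> :: bool. sum B U + (if \<alpha> then w ^ 4 * B z else 0) \<in> J 5"
      using E_add_cases[OF U(2), of "w ^ 4 * B z"] level4_digit[OF Ez] by (auto simp: ex_bool_eq)
    then obtain \<alpha> :: bool where \<alpha>: "sum B U + (if \<alpha> then w ^ 4 * B z else 0) \<in> J 5" by blast
    define A where "A = sum B U + (if \<alpha> then w ^ 4 * B z else 0)"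
    define Z where "Z = (if \<alpha> then {z} else {})"
    have A: "A \<in> J 5" using \<alpha> by (simp add: A_def)
    have AZ: "A = sum B U + w ^ 4 * sum B Z" by (simp add: A_def Z_def)
    have AZ2: "sum B (Z \<union> {x, y}) = sum B Z + (B x + B y)"
      using xyz by (auto simp: Z_def)
    have Zs: "Z \<subseteq> {x, y, z}" "Z \<union> {x, y} \<subseteq> {x, y, z}" by (auto simp: Z_def)
    have sums: "sum B U + e * sum B {} + w ^ 4 * sum B Z = A"
      "sum B U + e * sum B {j} + w ^ 4 * sum B Z = A + e * B j"
      "sum B U + e * sum B {} + w ^ 4 * sum B (Z \<union> {x, y}) = A + w ^ 4 * (B x + B y)"
      "sum B U + e * sum B {j} + w ^ 4 * sum B (Z \<union> {x, y}) = A + w ^ 4 * (B x + B y) + e * B j"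
      unfolding AZ2 by (simp_all add: AZ algebra_simps)
    have c1: "A \<notin> J 7" "A + e * B j \<notin> J 7" "A + w ^ 4 * (B x + B y) \<notin> J 7"
        "A + w ^ 4 * (B x + B y) + e * B j \<notin> J 7" if "\<not> has_approx_zero I B"
      using that fz[of "{}" Z, unfolded sums] fz[of "{j}" Z, unfolded sums] fz[of "{}" "Z \<union> {x, y}", unfolded sums]
        fz[of "{j}" "Z \<union> {x, y}", unfolded sums] Zs by blast+
    show ?thesis
    proof (rule ccontr)
      assume "\<not> ?thesis"
      note c = c1[OF this]
      \<comment> \<open>Both the digit at \<open>w ^ 5\<close> and the correction of valuation 6 may
        call for \<open>e * B j\<close>. Using it twice has no effect modulo \<open>w ^ 7\<close>,
        so the four sums in \<open>c1\<close> cover all cases.\<close>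
      have two: "e * B j + e * B j \<in> J 7"
        using J_mult[OF E_J[OF E_2 order_refl] E_J[OF eB order_refl]] unfolding mult_2 by simp
      define s where "s = w ^ 4 * (B x + B y)"
      have *: "s \<in> E 6 \<or> s + e * B j \<in> E 6"
        using p level4_digit[of "B x + B y" 2] level4_digit[of "B x + B y + t" 2] tw
        by (auto simp: s_def distrib_left)
      have "A \<in> J 6 \<or> A + e * B j \<in> J 6" using E_add_cases[OF A eB] by simp
      then obtain h where h: "h = 0 \<or> h = e * B j" "A + h \<in> J 6" by (metis add.right_neutral)
      have "A + h \<in> E 6" using J_cases[OF h(2)] h(1) c by auto
      then have "A + h + s \<in> J 7 \<or> A + h + (s + e * B j) \<in> J 7"
        using * E_add[of "A + h" 6] by auto
      then show False
      proof
        assume "A + h + s \<in> J 7"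
        then show False using h(1) c(3,4) by (auto simp: s_def algebra_simps)
      next
        assume 2: "A + h + (s + e * B j) \<in> J 7"
        show False
        proof (cases "h = 0")
          case True
          then show False using 2 c(4) by (simp add: s_def algebra_simps)
        next
          case False
          then have "A + h + (s + e * B j) - (e * B j + e * B j) = A + s" using h(1) by simp
          then have "A + s \<in> J 7" using J_diff[OF 2 two] by simp
          then show False using c(3) by (simp add: s_def)
        qed
      qed
    qed
  qed
  show ?thesis using three_units[OF E t] main[of i k l] main[of i l k] main[of k l i] ik E by blast
qed

section \<open>An anisotropic form in ten variables\<close>

text \<open>Separately, \<open>4 * h\<close> and \<open>6 * h ^ 2\<close> reach only valuation 6. If
  \<open>h\<close> has valuation exactly 2, then so have \<open>2\<close> and \<open>3 * h\<close>,
  and their sum gains the missing power of \<open>w\<close>.\<close>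

lemma quartic_one_plus_J2:
  assumes "h \<in> J 2"
  shows "(1 + h) ^ 4 - 1 \<in> J 7"
proof -
  have eq: "(1 + h) ^ 4 - 1 = 2 * h * (2 + 3 * h) + h ^ 3 * (4 + h)"
    by (simp add: algebra_simps power4_eq_xxxx power3_eq_cube)
  have J2: "2 \<in> J 2" and J4: "4 \<in> J 0" using E_J[OF E_2, of 2] by (auto simp: J_0)
  have J3: "3 * h \<in> J 2" using J_mult[OF _ assms, of 3 0] by (simp add: J_0)
  have h3: "h ^ 3 * (4 + h) \<in> J (int 3 * 2 + 2)"
    using E_J[OF E_4, of 2] assms by (intro J_mult J_power J_add) auto
  have "2 * h * (2 + 3 * h) \<in> J 7"
  proof (cases "h \<in> J 3")
    case True
    then have "2 * h * (2 + 3 * h) \<in> J (2 + 3 + 2)" using J2 J3 by (intro J_mult J_add)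
    then show ?thesis by simp
  next
    case False
    then have "h \<in> E 2" using J_cases[OF assms] by simp
    then have "3 * h \<in> E (0 + 2)" using E_odd[of 3] by (intro E_mult) auto
    then have "2 + 3 * h \<in> J 3" using E_add[OF E_2, of "3 * h"] by simp
    then have "2 * h * (2 + 3 * h) \<in> J (2 + 2 + 3)" using J2 assms by (intro J_mult)
    then show ?thesis by simp
  qed
  then show ?thesis unfolding eq using J_mono[OF _ h3, of 7] by (intro J_add) auto
qed

abbreviation "eps \<equiv> (1 + w) ^ 4 - 1"

lemma one_plus_w: "1 + w \<in> E 0"
  using E_add_J[of 1 0 w] E_J[OF E_w, of 1] E_odd[of 1] by simp

text \<open>A unit is congruent to \<open>1\<close> or to \<open>1 + w\<close> modulo
  \<open>w ^ 2\<close>, so it equals \<open>1 + h\<close> or \<open>(1 + w) * (1 + h)\<close> with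
  \<open>h\<close> in \<open>J 2\<close>.\<close>

lemma unit_quartic:
  assumes "x \<in> E 0"
  shows "x ^ 4 - 1 \<in> J 7 \<or> x ^ 4 - (1 + eps) \<in> J 7"
proof -
  have one: "- 1 \<in> E 0" using E_uminus[of 1 0] E_odd[of 1] by simp
  have x1: "x + - 1 \<in> J 1" using E_add[OF assms one] by simp
  show ?thesis
  proof (cases "x - 1 \<in> J 2")
    case True
    then show ?thesis using quartic_one_plus_J2[of "x - 1"] by simp
  next
    case False
    then have "x - 1 \<in> E 1" using J_cases[of "x - 1" 1] x1 by simp
    then have "x - 1 + - w \<in> J 2" using E_add[of "x - 1" 1 "- w"] E_uminus[OF E_w] by simp
    then have "(x - 1 + - w) / (1 + w) \<in> J (2 - 0)" using one_plus_w by (rule J_divide)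
    moreover define h where "h = (x - 1 + - w) / (1 + w)"
    ultimately have "(1 + h) ^ 4 - 1 \<in> J 7" using quartic_one_plus_J2[of h] by simp
    then have "(1 + w) ^ 4 * ((1 + h) ^ 4 - 1) \<in> J (int 4 * 0 + 7)"
      using E_J[OF one_plus_w order_refl] by (intro J_mult J_power)
    moreover have "x = (1 + w) * (1 + h)"
      using E_nz[OF one_plus_w] by (simp add: h_def field_simps)
    then have "x ^ 4 = (1 + w) ^ 4 * (1 + h) ^ 4" by (simp only: power_mult_distrib)
    then have "x ^ 4 - (1 + eps) = (1 + w) ^ 4 * ((1 + h) ^ 4 - 1)" by (simp add: right_diff_distrib)
    ultimately show ?thesis by simp
  qed
qed

lemma nonunit_quartic:
  assumes "x \<in> J 1"
  shows "x ^ 4 \<in> J 8 \<or> x ^ 4 - w ^ 4 \<in> J 8"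
proof (cases "x \<in> J 2")
  case True
  then show ?thesis using J_power[OF True, of 4] by simp
next
  case False
  then have "x \<in> E 1" using J_cases[OF assms] by simp
  then have y: "x / w \<in> E 0" using E_divide[OF _ E_w] by fastforce
  have "(x / w) ^ 4 - 1 \<in> J 4"
    using unit_quartic[OF y]
  proof
    assume "(x / w) ^ 4 - 1 \<in> J 7"
    then show ?thesis by (rule J_mono[rotated]) simp
  next
    assume "(x / w) ^ 4 - (1 + eps) \<in> J 7"
    then have "((x / w) ^ 4 - (1 + eps)) + eps \<in> J 4"
      using E_J[OF eps_E, of 4] J_mono[of 4 7] by (intro J_add) auto
    then show ?thesis by simp
  qed
  then have "w ^ 4 * ((x / w) ^ 4 - 1) \<in> J (4 + 4)"
    using E_J[OF E_powi[of 4], of 4] by (intro J_mult) auto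
  then show ?thesis by (simp add: power_divide right_diff_distrib)
qed

text \<open>In this form the values can be added up with integer coefficients. The sharper modulus
  \<open>w ^ 8\<close> for nonunits serves the case of \<open>anisotropic\<close> in which the
  relation is divided by \<open>w\<close>.\<close>

lemma quartic_expansion:
  assumes "x \<in> J 0"
  shows "\<exists>\<alpha> \<beta> \<gamma> :: int. 0 \<le> \<alpha> \<and> 0 \<le> \<beta> \<and> 0 \<le> \<gamma> \<and> \<alpha> + \<gamma> \<le> 1 \<and> (x \<in> E 0 \<longrightarrow> \<alpha> = 1)
    \<and> x ^ 4 - (of_int \<alpha> + of_int \<beta> * eps + of_int \<gamma> * w ^ 4) \<in> J 7
    \<and> (x \<notin> E 0 \<longrightarrow> \<alpha> = 0 \<and> \<beta> = 0 \<and> x ^ 4 - of_int \<gamma> * w ^ 4 \<in> J 8)"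
proof (cases "x \<in> E 0")
  case True
  from unit_quartic[OF True] show ?thesis
  proof
    assume "x ^ 4 - 1 \<in> J 7"
    then show ?thesis using True by (intro exI[of _ 1] exI[of _ 0]) simp
  next
    assume "x ^ 4 - (1 + eps) \<in> J 7"
    then show ?thesis using True
      by (intro exI[of _ "1 :: int"] exI[of _ "1 :: int"] exI[of _ "0 :: int"]) simp
  qed
next
  case False
  then have "x \<in> J 1" using J_cases[OF assms] by simp
  from nonunit_quartic[OF this] show ?thesis
  proof
    assume "x ^ 4 \<in> J 8"
    then show ?thesis using False J_mono[of 7 8 "x ^ 4"] by (intro exI[of _ 0]) simp
  next
    assume "x ^ 4 - w ^ 4 \<in> J 8"
    then show ?thesis using False J_mono[of 7 8 "x ^ 4 - w ^ 4"]
      by (intro exI[of _ "0 :: int"] exI[of _ "1 :: int"]) simp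
  qed
qed

lemma quartic_sum_expansion:
  assumes "finite A" "\<And>i. i \<in> A \<Longrightarrow> z i \<in> J 0"
  shows "\<exists>\<alpha> \<beta> \<gamma> :: int. 0 \<le> \<alpha> \<and> 0 \<le> \<beta> \<and> 0 \<le> \<gamma> \<and> \<alpha> + \<gamma> \<le> int (card A)
    \<and> ((\<exists>i\<in>A. z i \<in> E 0) \<longrightarrow> \<alpha> \<ge> 1)
    \<and> (\<Sum>i\<in>A. z i ^ 4) - (of_int \<alpha> + of_int \<beta> * eps + of_int \<gamma> * w ^ 4) \<in> J 7
    \<and> ((\<forall>i\<in>A. z i \<notin> E 0) \<longrightarrow> \<alpha> = 0 \<and> \<beta> = 0 \<and> (\<Sum>i\<in>A. z i ^ 4) - of_int \<gamma> * w ^ 4 \<in> J 8)"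
  using assms
proof (induction A rule: finite_induct)
  case empty
  show ?case by (intro exI[of _ 0]) simp
next
  case (insert a A)
  obtain \<alpha> \<beta> \<gamma> :: int where 1: "0 \<le> \<alpha>" "0 \<le> \<beta>" "0 \<le> \<gamma>" "\<alpha> + \<gamma> \<le> int (card A)"
      "(\<exists>i\<in>A. z i \<in> E 0) \<Longrightarrow> \<alpha> \<ge> 1"
      "(\<Sum>i\<in>A. z i ^ 4) - (of_int \<alpha> + of_int \<beta> * eps + of_int \<gamma> * w ^ 4) \<in> J 7"
      "(\<forall>i\<in>A. z i \<notin> E 0) \<Longrightarrow> \<alpha> = 0 \<and> \<beta> = 0 \<and> (\<Sum>i\<in>A. z i ^ 4) - of_int \<gamma> * w ^ 4 \<in> J 8"
    using insert.IH insert.prems by (metis insertCI)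
  obtain \<alpha>' \<beta>' \<gamma>' :: int where 2: "0 \<le> \<alpha>'" "0 \<le> \<beta>'" "0 \<le> \<gamma>'" "\<alpha>' + \<gamma>' \<le> 1"
      "z a \<in> E 0 \<Longrightarrow> \<alpha>' = 1"
      "z a ^ 4 - (of_int \<alpha>' + of_int \<beta>' * eps + of_int \<gamma>' * w ^ 4) \<in> J 7"
      "z a \<notin> E 0 \<Longrightarrow> \<alpha>' = 0 \<and> \<beta>' = 0 \<and> z a ^ 4 - of_int \<gamma>' * w ^ 4 \<in> J 8"
    using quartic_expansion[of "z a"] insert.prems by (metis insertI1)
  have s: "(\<Sum>i\<in>insert a A. z i ^ 4) = z a ^ 4 + (\<Sum>i\<in>A. z i ^ 4)" using insert.hyps by simp
  have "(\<Sum>i\<in>insert a A. z i ^ 4)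
      - (of_int (\<alpha> + \<alpha>') + of_int (\<beta> + \<beta>') * eps + of_int (\<gamma> + \<gamma>') * w ^ 4) \<in> J 7"
    unfolding s using J_add[OF 1(6) 2(6)] by (simp add: algebra_simps)
  moreover have "\<alpha> + \<alpha>' = 0 \<and> \<beta> + \<beta>' = 0 \<and> (\<Sum>i\<in>insert a A. z i ^ 4) - of_int (\<gamma> + \<gamma>') * w ^ 4 \<in> J 8"
    if "\<forall>i\<in>insert a A. z i \<notin> E 0"
    unfolding s using 1(7) 2(7) that J_add[of _ 8 "z a ^ 4 - of_int \<gamma>' * w ^ 4"] by (force simp: algebra_simps)
  moreover have "\<alpha> + \<alpha>' \<ge> 1" if "\<exists>i\<in>insert a A. z i \<in> E 0"
    using that 1(1,5) 2(1,5) by force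
  moreover have "(\<alpha> + \<alpha>') + (\<gamma> + \<gamma>') \<le> int (card (insert a A))" using 1(4) 2(4) insert.hyps by simp
  ultimately show ?case using 1(1-3) 2(1-3)
    by (intro exI[of _ "\<alpha> + \<alpha>'"] exI[of _ "\<beta> + \<beta>'"] exI[of _ "\<gamma> + \<gamma>'"]) auto
qed

lemma int_J8: "of_int p + of_int q * w \<in> J 8 \<Longrightarrow> 16 dvd p \<and> 16 dvd q"
proof -
  have *: "16 dvd p" if "small2 4 (of_int p)" for p
  proof (cases "p = 0")
    case False
    have "of_int p \<in> J 8" using that small2_iff[of 4 "of_int p"] by simp
    then have "4 \<le> multiplicity (2 :: int) p" using E_J_iff[OF int_E[OF False], of 8] by simp
    then have "(2 :: int) ^ 4 dvd p" by (rule multiplicity_dvd')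
    then show ?thesis by simp
  qed simp
  assume "of_int p + of_int q * w \<in> J 8"
  then show ?thesis using emb_J[of "(of_int p, of_int q)" 4] * by (simp add: emb_def)
qed

text \<open>Multiplication by \<open>w\<close> interchanges the coordinates and reduces to
  \<open>int_J8\<close>; the factor 2 of \<open>d\<close> accounts for 8 in place of 16.\<close>

lemma int_J7: "of_int p + of_int q * w \<in> J 7 \<Longrightarrow> 16 dvd p \<and> 8 dvd q"
proof -
  assume "of_int p + of_int q * w \<in> J 7"
  then have "(of_int p + of_int q * w) * w \<in> J (7 + 1)" using E_J[OF E_w order_refl] by (rule J_mult)
  moreover have "(of_int p + of_int q * w) * w = of_int (q * d) + of_int p * w"
    using w_sq(1) by (simp add: algebra_simps)
  ultimately have *: "16 dvd q * d" "16 dvd p" using int_J8[of "q * d" p] by simp_all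
  obtain u where u: "d = 2 * u" "odd u" by (rule d_half)
  have "2 * 8 dvd 2 * (q * u)" using *(1) u(1) by (simp add: mult.left_commute)
  then have "8 dvd q * u" by (subst (asm) dvd_mult_cancel_left) simp
  moreover have "coprime (2 ^ 3) u" using u(2) by (subst coprime_power_left_iff) (simp add: coprime_left_2_iff_odd)
  ultimately show ?thesis using *(2) coprime_dvd_mult_left_iff[of 8 u q] by simp
qed

lemma eps_eq: "eps = of_int (6 * d + d ^ 2) + of_int (4 + 4 * d) * w"
proof -
  have "eps = 4 * w * (1 + w\<^sup>2) + (6 * w\<^sup>2 + (w\<^sup>2)\<^sup>2)"
    by (simp add: algebra_simps power4_eq_xxxx power2_eq_square)
  then show ?thesis by (simp add: w_sq algebra_simps)
qed

lemma w4_eq: "w ^ 4 = of_int (d ^ 2)"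
  using w_sq(2) by (metis of_int_power power2_eq_square mult_2 numeral_Bit0 power_add)

text \<open>For the four values of \<open>d\<close> this is the digit of \<open>(1 + w)\<^sup>4\<close> at \<open>w\<^sup>6\<close>.\<close>

definition twist :: int where "twist = (if d < 0 then 1 else 0)"

text \<open>If one of the first four variables is a unit, reduction modulo \<open>w ^ 7\<close>
  gives \<open>8 dvd M + 4 * G\<close> with \<open>M \<ge> 1\<close> and
  \<open>M + G \<le> 4\<close>; this forces \<open>M = 4\<close>, \<open>G = 0\<close>, a
  contradiction. Otherwise one of the last six is a unit, and after division by \<open>w\<close> one
  gets \<open>16 dvd m + 4 * g\<close> with \<open>m \<ge> 1\<close> and
  \<open>m + g \<le> 6\<close>; this forces \<open>m = 4\<close>, \<open>g \<le> 2\<close>, again a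
  contradiction.\<close>

lemma anisotropic:
  fixes z :: "nat \<Rightarrow> complex"
  assumes d: "d \<in> {2, 10, -2, -10}" and z: "\<And>i. i < 10 \<Longrightarrow> z i \<in> J 0" "i0 < 10" "z i0 \<in> E 0"
  shows "(\<Sum>i<4. z i ^ 4) + w * (1 + of_int twist * w) * (\<Sum>i=4..<10. z i ^ 4) \<notin> J 8"
proof
  define X where "X = (\<Sum>i<4. z i ^ 4)"
  define Y where "Y = (\<Sum>i=4..<10. z i ^ 4)"
  define \<kappa> where "\<kappa> = 1 + of_int twist * w"
  assume "(\<Sum>i<4. z i ^ 4) + w * (1 + of_int twist * w) * (\<Sum>i=4..<10. z i ^ 4) \<in> J 8"
  then have T: "X + w * \<kappa> * Y \<in> J 8" by (simp add: X_def Y_def \<kappa>_def)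
  have \<kappa>: "w * \<kappa> \<in> J (1 + 0)"
    unfolding \<kappa>_def using E_J[OF E_w order_refl] O_add[OF O_simps(2) O_mult[OF O_int O_w]]
    by (intro J_mult) (simp_all add: J_0)
  obtain M E' G :: int where X: "0 \<le> M" "0 \<le> E'" "0 \<le> G" "M + G \<le> 4"
      "(\<exists>i\<in>{..<4}. z i \<in> E 0) \<Longrightarrow> M \<ge> 1"
      "X - (of_int M + of_int E' * eps + of_int G * w ^ 4) \<in> J 7"
      "(\<forall>i\<in>{..<4}. z i \<notin> E 0) \<Longrightarrow> M = 0 \<and> E' = 0 \<and> X - of_int G * w ^ 4 \<in> J 8"
    using quartic_sum_expansion[of "{..<4}" z] z(1) unfolding X_def by auto
  obtain m e g :: int where Y: "0 \<le> m" "0 \<le> e" "0 \<le> g" "m + g \<le> 6"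
      "(\<exists>i\<in>{4..<10}. z i \<in> E 0) \<Longrightarrow> m \<ge> 1"
      "Y - (of_int m + of_int e * eps + of_int g * w ^ 4) \<in> J 7"
    using quartic_sum_expansion[of "{4..<10}" z] z(1) unfolding Y_def by auto
  define a where "a = m + e * (6 * d + d ^ 2) + g * d ^ 2"
  define b where "b = e * (4 + 4 * d)"
  have ab: "of_int m + of_int e * eps + of_int g * w ^ 4 = of_int a + of_int b * w"
    unfolding a_def b_def eps_eq w4_eq by (simp add: algebra_simps)
  have Y': "w * \<kappa> * (Y - (of_int a + of_int b * w)) \<in> J (1 + 0 + 7)"
    using J_mult[OF \<kappa> Y(6)] unfolding ab .
  show False
  proof (cases "\<exists>i\<in>{..<4}. z i \<in> E 0")
    case True
    have "(X + w * \<kappa> * Y) - (X - (of_int M + of_int E' * eps + of_int G * w ^ 4))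
        - w * \<kappa> * (Y - (of_int a + of_int b * w)) \<in> J 7"
      by (rule J_diff[OF J_diff[OF J_mono[OF _ T] X(6)] J_mono[OF _ Y']]) simp_all
    also have "(X + w * \<kappa> * Y) - (X - (of_int M + of_int E' * eps + of_int G * w ^ 4))
        - w * \<kappa> * (Y - (of_int a + of_int b * w))
        = of_int M + of_int E' * eps + of_int G * w ^ 4
          + (w * w * (of_int twist * of_int a + of_int b) + (of_int a + (w * w) * (of_int twist * of_int b)) * w)"
      by (simp add: \<kappa>_def algebra_simps)
    also have "\<dots> = of_int (M + E' * (6 * d + d ^ 2) + G * d ^ 2 + d * (twist * a + b))
        + of_int (E' * (4 + 4 * d) + a + d * (twist * b)) * w"
      unfolding eps_eq w4_eq w_sq by (simp add: algebra_simps)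
    finally have "16 dvd M + E' * (6 * d + d ^ 2) + G * d ^ 2 + d * (twist * a + b)
        \<and> 8 dvd E' * (4 + 4 * d) + a + d * (twist * b)"
      by (rule int_J7)
    moreover have "M \<ge> 1" using X(5) True .
    ultimately obtain k l where kl: "M + E' * (6 * d + d ^ 2) + G * d ^ 2 + d * (twist * a + b) = 16 * k"
        "E' * (4 + 4 * d) + a + d * (twist * b) = 8 * l" and M: "M \<ge> 1" by (elim conjE dvdE) blast
    consider "d = 2" | "d = 10" | "d = -2" | "d = -10" using d by blast
    \<comment> \<open>The witnesses come from solving the first equation of \<open>kl\<close> for
      \<open>M + 4 * G\<close>; for negative \<open>d\<close> the second equation eliminates
      \<open>a\<close>. All remaining coefficients are multiples of 8.\<close>
    then have "\<exists>h. M + 4 * G = 8 * h"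
    proof cases
      case 1
      then have t: "twist = 0" unfolding twist_def by simp
      show ?thesis using kl unfolding t a_def b_def
        by (intro exI[of _ "2 * k - 2 * E' - 3 * e"]) (simp add: 1)
    next
      case 2
      then have t: "twist = 0" unfolding twist_def by simp
      show ?thesis using kl unfolding t a_def b_def
        by (intro exI[of _ "2 * k - 20 * E' - 12 * G - 55 * e"]) (simp add: 2)
    next
      case 3
      then have t: "twist = 1" unfolding twist_def by simp
      show ?thesis using kl unfolding t a_def b_def
        by (intro exI[of _ "2 * k + 2 * E' + 2 * l - 3 * e"]) (simp add: 3)
    next
      case 4
      then have t: "twist = 1" unfolding twist_def by simp
      show ?thesis using kl unfolding t a_def b_def
        by (intro exI[of _ "2 * k + 40 * E' - 12 * G + 10 * l - 495 * e"]) (simp add: 4)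
    qed
    then show False using M X(1-4) by presburger
  next
    case False
    then have X8: "X - of_int G * w ^ 4 \<in> J 8" using X(7) by blast
    have m: "m \<ge> 1" using False z(2,3) by (intro Y(5)) (auto simp: not_less Bex_def)
    have "(X + w * \<kappa> * Y) - (X - of_int G * w ^ 4) - w * \<kappa> * (Y - (of_int a + of_int b * w)) \<in> J 8"
      by (rule J_diff[OF J_diff[OF T X8] J_mono[OF _ Y']]) simp
    also have "(X + w * \<kappa> * Y) - (X - of_int G * w ^ 4) - w * \<kappa> * (Y - (of_int a + of_int b * w))
        = (of_int a + (w * w) * (of_int twist * of_int b)
          + ((w * w) * of_int G + of_int b + of_int twist * of_int a) * w) * w"
      by (simp add: \<kappa>_def algebra_simps power4_eq_xxxx)
    finally have "of_int a + (w * w) * (of_int twist * of_int b)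
          + ((w * w) * of_int G + of_int b + of_int twist * of_int a) * w \<in> J 7"
      using E_J_mult_iff[OF E_w, of _ 7] by simp
    then have "of_int (a + d * (twist * b)) + of_int (d * G + b + twist * a) * w \<in> J 7"
      by (simp add: w_sq)
    then have "16 dvd a + d * (twist * b) \<and> 8 dvd d * G + b + twist * a" by (rule int_J7)
    then obtain k where k: "a + d * (twist * b) = 16 * k" by (elim conjE dvdE)
    consider "d = 2" | "d = 10" | "d = -2" | "d = -10" using d by blast
    \<comment> \<open>The coefficient of \<open>e\<close> is
      \<open>6 * d + d ^ 2 + twist * d * (4 + 4 * d)\<close>, that is 16, 160, 0, 400 in the four
      cases. For negative \<open>d\<close> it is divisible by 16 only thanks to the twist.\<close>
    then have "\<exists>h. m + 4 * g = 16 * h"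
    proof cases
      case 1
      then have t: "twist = 0" unfolding twist_def by simp
      show ?thesis using k unfolding t a_def b_def
        by (intro exI[of _ "k - e"]) (simp add: 1)
    next
      case 2
      then have t: "twist = 0" unfolding twist_def by simp
      show ?thesis using k unfolding t a_def b_def
        by (intro exI[of _ "k - 10 * e - 6 * g"]) (simp add: 2)
    next
      case 3
      then have t: "twist = 1" unfolding twist_def by simp
      show ?thesis using k unfolding t a_def b_def
        by (intro exI[of _ k]) (simp add: 3)
    next
      case 4
      then have t: "twist = 1" unfolding twist_def by simp
      show ?thesis using k unfolding t a_def b_def
        by (intro exI[of _ "k - 25 * e - 6 * g"]) (simp add: 4)
    qed
    then show False using m Y(1-4) by presburger
  qed
qed

end

section \<open>Sums of coordinates modulo four\<close>

locale coordinates =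
  fixes P Q :: "'a \<Rightarrow> int"
begin

text \<open>The sum over \<open>U\<close> lies in the Klein four-group, and \<open>a\<close>, \<open>b\<close> tell which of its two coordinates vanish
  modulo \<open>4\<close>. In this encoding addition of classes is the equivalence of truth values.\<close>

definition cls :: "'a set \<Rightarrow> bool \<Rightarrow> bool \<Rightarrow> bool" where
  "cls U a b \<longleftrightarrow> finite U \<and> even (sum P U) \<and> even (sum Q U)
     \<and> (4 dvd sum P U \<longleftrightarrow> a) \<and> (4 dvd sum Q U \<longleftrightarrow> b)"

lemma cls_finite: "cls U a b \<Longrightarrow> finite U" by (simp add: cls_def)

lemma four_dvd_add_iff:
  fixes x y :: int
  assumes "even x" "even y"
  shows "4 dvd x + y \<longleftrightarrow> (4 dvd x \<longleftrightarrow> 4 dvd y)"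
  using assms by presburger

lemma cls_Un:
  assumes "cls U a b" "cls U' a' b'" "U \<inter> U' = {}"
  shows "cls (U \<union> U') (a = a') (b = b')"
  using assms unfolding cls_def by (simp add: sum.union_disjoint four_dvd_add_iff)

lemma cls_Un_eq:
  assumes "cls U a b" "cls U' a b" "U \<inter> U' = {}"
  shows "cls (U \<union> U') True True"
  using cls_Un[OF assms] by simp

lemma cls_pair:
  assumes "i \<noteq> k" "even (P i + P k)" "even (Q i + Q k)"
  shows "cls {i, k} (4 dvd P i + P k) (4 dvd Q i + Q k)"
  using assms by (simp add: cls_def)

lemma card_ge_2_obtain:
  assumes "card S \<ge> 2" obtains i k where "i \<in> S" "k \<in> S" "i \<noteq> k"
proof -
  obtain T where "T \<subseteq> S" "card T = 2" using obtain_subset_with_card_n[OF assms] by metis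
  then show ?thesis using that unfolding card_2_iff by blast
qed

lemma card_ge_3_obtain:
  assumes "card S \<ge> 3" obtains i k l where "i \<in> S" "k \<in> S" "l \<in> S" "i \<noteq> k" "i \<noteq> l" "k \<noteq> l"
proof -
  obtain T where "T \<subseteq> S" "card T = 3" using obtain_subset_with_card_n[OF assms] by metis
  then show ?thesis using that unfolding card_3_iff by blast
qed

text \<open>Pigeonhole on the parity of \<open>Q\<close>: two of three units agree there, and all
  agree in the parity of \<open>P\<close>.\<close>

lemma unit_pair:
  assumes "card S \<ge> 3" "\<And>i. i \<in> S \<Longrightarrow> odd (P i)"
  shows "\<exists>U a b. U \<subseteq> S \<and> card U = 2 \<and> cls U a b"
proof -
  obtain i k l where *: "i \<in> S" "k \<in> S" "l \<in> S" "i \<noteq> k" "i \<noteq> l" "k \<noteq> l"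
    using card_ge_3_obtain[OF assms(1)] by metis
  have odd: "odd (P i)" "odd (P k)" "odd (P l)" using * assms(2) by auto
  consider "even (Q i + Q k)" | "even (Q i + Q l)" | "even (Q k + Q l)" by auto
  then have "\<exists>x y. x \<in> S \<and> y \<in> S \<and> x \<noteq> y \<and> even (P x + P y) \<and> even (Q x + Q y)"
    by cases (use * odd in \<open>auto intro: exI\<close>)
  then obtain x y where "x \<in> S" "y \<in> S" "x \<noteq> y" "even (P x + P y)" "even (Q x + Q y)" by blast
  then show ?thesis using cls_pair[of x y] by (intro exI[of _ "{x, y}"]) auto
qed

lemma card_Diff_ge: "finite U \<Longrightarrow> card (S - U) \<ge> card S - card U"
  by (rule diff_card_le_card_Diff)

lemma two_unit_pairs:
  assumes "card S \<ge> 5" "\<And>i. i \<in> S \<Longrightarrow> odd (P i)"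
  shows "\<exists>U1 U2 a1 b1 a2 b2. U1 \<subseteq> S \<and> U2 \<subseteq> S \<and> U1 \<inter> U2 = {} \<and> card U1 = 2 \<and> card U2 = 2
    \<and> cls U1 a1 b1 \<and> cls U2 a2 b2"
proof -
  obtain U1 a1 b1 where U1: "U1 \<subseteq> S" "card U1 = 2" "cls U1 a1 b1"
    using unit_pair[of S] assms by auto
  have "card (S - U1) \<ge> 3" using card_Diff_ge[of U1 S] U1 cls_finite assms by fastforce
  then obtain U2 a2 b2 where U2: "U2 \<subseteq> S - U1" "card U2 = 2" "cls U2 a2 b2"
    using unit_pair[of "S - U1"] assms by auto
  show ?thesis using U1 U2 by blast
qed

lemma three_unit_pairs:
  assumes "card S \<ge> 7" "\<And>i. i \<in> S \<Longrightarrow> odd (P i)"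
  shows "\<exists>U1 U2 U3 a1 b1 a2 b2 a3 b3. U1 \<subseteq> S \<and> U2 \<subseteq> S \<and> U3 \<subseteq> S
    \<and> U1 \<inter> U2 = {} \<and> U1 \<inter> U3 = {} \<and> U2 \<inter> U3 = {} \<and> card U1 = 2 \<and> card U2 = 2 \<and> card U3 = 2
    \<and> cls U1 a1 b1 \<and> cls U2 a2 b2 \<and> cls U3 a3 b3"
proof -
  obtain U1 a1 b1 where U1: "U1 \<subseteq> S" "card U1 = 2" "cls U1 a1 b1"
    using unit_pair[of S] assms by auto
  have "card (S - U1) \<ge> 5" using card_Diff_ge[of U1 S] U1 cls_finite assms by fastforce
  then obtain U2 U3 a2 b2 a3 b3 where "U2 \<subseteq> S - U1" "U3 \<subseteq> S - U1" "U2 \<inter> U3 = {}"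
     "card U2 = 2" "card U3 = 2" "cls U2 a2 b2" "cls U3 a3 b3"
    using two_unit_pairs[of "S - U1"] assms by (metis Diff_iff)
  then show ?thesis using U1 by (intro exI[of _ U1] exI[of _ U2] exI[of _ U3]) blast
qed

text \<open>The bound 4 controls how many units are consumed: five units leave one spare, seven
  leave three.\<close>

definition reach :: "'a set \<Rightarrow> bool \<Rightarrow> bool \<Rightarrow> bool" where
  "reach S a b \<longleftrightarrow> (\<exists>U\<subseteq>S. U \<noteq> {} \<and> card U \<le> 4 \<and> cls U a b)"

lemma reachI: "U \<subseteq> S \<Longrightarrow> card U = 2 \<Longrightarrow> cls U a b \<Longrightarrow> reach S a b"
  unfolding reach_def by (intro exI[of _ U]) auto

lemma reach_Un:
  assumes "U1 \<subseteq> S" "U2 \<subseteq> S" "U1 \<inter> U2 = {}" "card U1 = 2" "card U2 = 2" "cls U1 a1 b1" "cls U2 a2 b2"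
  shows "reach S (a1 = a2) (b1 = b2)"
proof -
  have "card (U1 \<union> U2) = 4"
    using assms card_Un_disjoint[of U1 U2] cls_finite[OF assms(6)] cls_finite[OF assms(7)] by simp
  then show ?thesis unfolding reach_def
    using cls_Un[OF assms(6,7,3)] assms(1,2) by (intro exI[of _ "U1 \<union> U2"]) auto
qed

text \<open>If two classes of the Klein four-group are nonzero and distinct, then they and their sum
  are all three nonzero classes; otherwise one of them or their sum is zero.\<close>

lemma reach_span:
  assumes "U1 \<subseteq> S" "U2 \<subseteq> S" "U1 \<inter> U2 = {}" "card U1 = 2" "card U2 = 2" "cls U1 a1 b1" "cls U2 a2 b2"
  shows "reach S True True \<or> (reach S True False \<and> reach S False True \<and> reach S False False)"
proof -
  note reachI[OF assms(1,4,6)] reachI[OF assms(2,5,7)] reach_Un[OF assms]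
  then show ?thesis by (cases a1; cases b1; cases a2; cases b2) simp_all
qed

text \<open>For the second claim, three of the five units agree in the parity of \<open>Q\<close>.
  Two of these also have \<open>P\<close> congruent modulo 4, and then their \<open>P\<close> sum is
  2 modulo 4, so that this pair has a nonzero class.\<close>

lemma unit_reach:
  assumes S: "card S \<ge> 5" "\<And>i. i \<in> S \<Longrightarrow> odd (P i)"
  shows "reach S True True \<or> (reach S True False \<and> reach S False True \<and> reach S False False)"
    and "reach S True False \<or> reach S False True \<or> reach S False False"
proof -
  show "reach S True True \<or> (reach S True False \<and> reach S False True \<and> reach S False False)"
  proof -
    obtain U1 U2 a1 b1 a2 b2 where "U1 \<subseteq> S" "U2 \<subseteq> S" "U1 \<inter> U2 = {}" "card U1 = 2" "card U2 = 2"
      "cls U1 a1 b1" "cls U2 a2 b2"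
      using two_unit_pairs[OF S] by metis
    then show ?thesis by (rule reach_span)
  qed
  have fin: "finite S" using S(1) by (metis card.infinite not_numeral_le_zero)
  have "card {i \<in> S. even (Q i)} + card {i \<in> S. odd (Q i)} = card S"
    using fin by (subst card_Un_disjoint[symmetric]) (auto intro: arg_cong[of _ _ card])
  then consider "card {i \<in> S. even (Q i)} \<ge> 3" | "card {i \<in> S. odd (Q i)} \<ge> 3" using S(1) by linarith
  then obtain i k l where *: "i \<in> S" "k \<in> S" "l \<in> S" "i \<noteq> k" "i \<noteq> l" "k \<noteq> l"
     "even (Q i + Q k)" "even (Q i + Q l)" "even (Q k + Q l)"
  proof cases
    case 1
    then show ?thesis using that by (elim card_ge_3_obtain) auto
  next
    case 2
    then show ?thesis using that by (elim card_ge_3_obtain) auto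
  qed
  have odd: "odd (P i)" "odd (P k)" "odd (P l)" using * S(2) by auto
  have "\<not> 4 dvd P i + P k \<or> \<not> 4 dvd P i + P l \<or> \<not> 4 dvd P k + P l"
    using odd by presburger
  moreover have "reach S (4 dvd P x + P y) (4 dvd Q x + Q y)"
    if "x \<in> S" "y \<in> S" "x \<noteq> y" "even (Q x + Q y)" "odd (P x)" "odd (P y)" for x y
    using that cls_pair[of x y] by (intro reachI[of "{x, y}"]) auto
  ultimately have "\<exists>x y. \<not> 4 dvd P x + P y \<and> reach S (4 dvd P x + P y) (4 dvd Q x + Q y)"
    using * odd by blast
  then show "reach S True False \<or> reach S False True \<or> reach S False False" by (metis (full_types))
qed

text \<open>The three pair sums of a triple add up to twice the sum of the triple.\<close>

lemma level1_triple:
  assumes "card S \<ge> 3" "\<And>i. i \<in> S \<Longrightarrow> even (P i) \<and> odd (Q i)"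
  shows "\<exists>a b. (a, b) \<noteq> (True, True) \<and> (a, b) \<noteq> (False, c) \<and> reach S a b"
proof -
  obtain i k l where *: "i \<in> S" "k \<in> S" "l \<in> S" "i \<noteq> k" "i \<noteq> l" "k \<noteq> l"
    using card_ge_3_obtain[OF assms(1)] by metis
  have par: "even (P i)" "even (P k)" "even (P l)" "odd (Q i)" "odd (Q k)" "odd (Q l)"
    using * assms(2) by auto
  have r: "reach S (4 dvd P x + P y) (4 dvd Q x + Q y)"
    if "x \<in> S" "y \<in> S" "x \<noteq> y" for x y
    using that cls_pair[of x y] assms(2) by (intro reachI[of "{x, y}"]) auto
  have r3: "reach S (4 dvd P i + P k) (4 dvd Q i + Q k)" "reach S (4 dvd P i + P l) (4 dvd Q i + Q l)"
    "reach S (4 dvd P k + P l) (4 dvd Q k + Q l)" using r * by auto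
  have e1: "(4 dvd P i + P k) = ((4 dvd P i + P l) = (4 dvd P k + P l))"
    using par by presburger
  have e2: "(4 dvd Q i + Q k) \<noteq> ((4 dvd Q i + Q l) = (4 dvd Q k + Q l))"
    using par by presburger
  \<comment> \<open>By \<open>e1\<close> and \<open>e2\<close> the three classes add up to
    \<open>(True, False)\<close>. The classes \<open>(True, True)\<close> and
    \<open>(False, c)\<close> form a subgroup that does not contain it, so one of the three lies
    outside.\<close>
  have *: "\<exists>a b. (a, b) \<noteq> (True, True) \<and> (a, b) \<noteq> (False, c) \<and> R a b"
    if "R a1 b1" "R a2 b2" "R a3 b3" "a1 = (a2 = a3)" "b1 \<noteq> (b2 = b3)" for R a1 a2 a3 b1 b2 b3
    using that by (cases a2; cases a3; cases b2; cases b3; cases c; simp add: ex_bool_eq)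
  show ?thesis by (rule *[of "reach S", OF r3 e1 e2])
qed

lemma level1_reach:
  assumes S: "card S \<ge> 4" "\<And>i. i \<in> S \<Longrightarrow> even (P i) \<and> odd (Q i)"
  shows "reach S True True \<or> (reach S True False \<and> reach S False True \<and> reach S False False)"
proof -
  obtain i k where ik: "i \<in> S" "k \<in> S" "i \<noteq> k" using S(1) by (elim card_ge_2_obtain[of S, rotated]) auto
  have "card (S - {i, k}) \<ge> 2" using card_Diff_ge[of "{i, k}" S] ik S(1) by simp
  then obtain l m where lm: "l \<in> S - {i, k}" "m \<in> S - {i, k}" "l \<noteq> m" by (rule card_ge_2_obtain)
  show ?thesis
    using ik lm S(2) cls_pair[of i k] cls_pair[of l m]
    by (intro reach_span[of "{i, k}" _ "{l, m}"]) auto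
qed

text \<open>The bits \<open>p\<close>, \<open>q\<close> fix the residues modulo 4 of five units with
  even \<open>Q\<close>; a pair sums to zero when the \<open>p\<close> differ and the
  \<open>q\<close> agree. Without such a pair at most two kinds occur, so four of the five split
  into two equal pairs. There is one pairing for each omitted unit, as the class of four does not
  depend on the pairing.\<close>

lemma quadruple_or_pair_even:
  "(p1 \<noteq> p2 \<and> q1 = q2) \<or> (p1 \<noteq> p3 \<and> q1 = q3) \<or> (p1 \<noteq> p4 \<and> q1 = q4) \<or> (p1 \<noteq> p5 \<and> q1 = q5) \<or>
   (p2 \<noteq> p3 \<and> q2 = q3) \<or> (p2 \<noteq> p4 \<and> q2 = q4) \<or> (p2 \<noteq> p5 \<and> q2 = q5) \<or>
   (p3 \<noteq> p4 \<and> q3 = q4) \<or> (p3 \<noteq> p5 \<and> q3 = q5) \<or> (p4 \<noteq> p5 \<and> q4 = q5) \<or>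
   ((p1 = p2) = (p3 = p4) \<and> (q1 = q2) = (q3 = q4)) \<or> ((p1 = p2) = (p3 = p5) \<and> (q1 = q2) = (q3 = q5)) \<or>
   ((p1 = p2) = (p4 = p5) \<and> (q1 = q2) = (q4 = q5)) \<or> ((p1 = p3) = (p4 = p5) \<and> (q1 = q3) = (q4 = q5)) \<or>
   ((p2 = p3) = (p4 = p5) \<and> (q2 = q3) = (q4 = q5))" for p1 p2 p3 p4 p5 q1 q2 q3 q4 q5 :: bool
  by (cases p1; cases p2; cases p3; cases p4; cases p5; simp; cases q1; cases q2; cases q3; cases q4; cases q5; simp)

text \<open>For odd \<open>Q\<close> a pair sums to zero when both bits differ; avoiding this again
  leaves at most two kinds.\<close>

lemma quadruple_or_pair_odd:
  "(p1 \<noteq> p2 \<and> q1 \<noteq> q2) \<or> (p1 \<noteq> p3 \<and> q1 \<noteq> q3) \<or> (p1 \<noteq> p4 \<and> q1 \<noteq> q4) \<or> (p1 \<noteq> p5 \<and> q1 \<noteq> q5) \<or>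
   (p2 \<noteq> p3 \<and> q2 \<noteq> q3) \<or> (p2 \<noteq> p4 \<and> q2 \<noteq> q4) \<or> (p2 \<noteq> p5 \<and> q2 \<noteq> q5) \<or>
   (p3 \<noteq> p4 \<and> q3 \<noteq> q4) \<or> (p3 \<noteq> p5 \<and> q3 \<noteq> q5) \<or> (p4 \<noteq> p5 \<and> q4 \<noteq> q5) \<or>
   ((p1 = p2) = (p3 = p4) \<and> (q1 = q2) = (q3 = q4)) \<or> ((p1 = p2) = (p3 = p5) \<and> (q1 = q2) = (q3 = q5)) \<or>
   ((p1 = p2) = (p4 = p5) \<and> (q1 = q2) = (q4 = q5)) \<or> ((p1 = p3) = (p4 = p5) \<and> (q1 = q3) = (q4 = q5)) \<or>
   ((p2 = p3) = (p4 = p5) \<and> (q2 = q3) = (q4 = q5))" for p1 p2 p3 p4 p5 q1 q2 q3 q4 q5 :: bool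
  by (cases p1; cases p2; cases p3; cases p4; cases p5; simp; cases q1; cases q2; cases q3; cases q4; cases q5; simp)

lemma five_units_reach:
  assumes C: "card C \<ge> 5" "\<And>i. i \<in> C \<Longrightarrow> odd (P i)"
    and par: "(\<forall>i\<in>C. even (Q i)) \<or> (\<forall>i\<in>C. odd (Q i))"
  shows "reach C True True"
proof (rule ccontr)
  assume neg: "\<not> reach C True True"
  obtain x1 x2 where x12: "x1 \<in> C" "x2 \<in> C" "x1 \<noteq> x2" using C(1) by (elim card_ge_2_obtain[of C, rotated]) auto
  have "card (C - {x1, x2}) \<ge> 3" using card_Diff_ge[of "{x1, x2}" C] x12 C(1) by simp
  then obtain x3 x4 x5 where x345: "x3 \<in> C - {x1, x2}" "x4 \<in> C - {x1, x2}" "x5 \<in> C - {x1, x2}"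
    "x3 \<noteq> x4" "x3 \<noteq> x5" "x4 \<noteq> x5" by (rule card_ge_3_obtain)
  have FF: "(False \<or> False) = False" by simp
  have xs: "x1 \<in> C" "x2 \<in> C" "x3 \<in> C" "x4 \<in> C" "x5 \<in> C" using x12 x345 by auto
  have ne: "x1 \<noteq> x2" "x1 \<noteq> x3" "x1 \<noteq> x4" "x1 \<noteq> x5" "x2 \<noteq> x3" "x2 \<noteq> x4" "x2 \<noteq> x5"
    "x3 \<noteq> x4" "x3 \<noteq> x5" "x4 \<noteq> x5" using x12 x345 by auto
  have disj: "{x1, x2} \<inter> {x3, x4} = {}" "{x1, x2} \<inter> {x3, x5} = {}" "{x1, x2} \<inter> {x4, x5} = {}"
    "{x1, x3} \<inter> {x4, x5} = {}" "{x2, x3} \<inter> {x4, x5} = {}" using ne by auto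
  \<comment> \<open>Once the parities are fixed, one bit per coordinate determines the residue
    modulo 4.\<close>
  define p where "p i \<longleftrightarrow> P i mod 4 = 1" for i
  define q where "q i \<longleftrightarrow> Q i mod 4 < 2" for i
  define a where "a i k \<longleftrightarrow> 4 dvd P i + P k" for i k
  define b where "b i k \<longleftrightarrow> 4 dvd Q i + Q k" for i k
  have a_p: "a i k \<longleftrightarrow> p i \<noteq> p k" if "i \<in> C" "k \<in> C" for i k
    using C(2)[OF that(1)] C(2)[OF that(2)] unfolding a_def p_def by presburger
  have pair: "cls {i, k} (a i k) (b i k)" if "i \<in> C" "k \<in> C" "i \<noteq> k" for i k
    unfolding a_def b_def using that C(2) par by (intro cls_pair) auto
  have no_pair: "\<not> (a i k \<and> b i k)" if "i \<in> C" "k \<in> C" "i \<noteq> k" for i k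
    using neg pair[OF that] reachI[of "{i, k}" C] that by auto
  have no_quad: "\<not> (a i k = a l m \<and> b i k = b l m)"
    if "i \<in> C" "k \<in> C" "l \<in> C" "m \<in> C" "i \<noteq> k" "l \<noteq> m" "{i, k} \<inter> {l, m} = {}" for i k l m
  proof
    assume h: "a i k = a l m \<and> b i k = b l m"
    have "reach C (a i k = a l m) (b i k = b l m)"
      using that by (intro reach_Un[OF _ _ that(7) _ _ pair[OF that(1,2,5)] pair[OF that(3,4,6)]]) auto
    then show False using neg by (simp add: h)
  qed
  show False
  proof (cases "\<forall>i\<in>C. even (Q i)")
    case True
    have b_q: "b i k \<longleftrightarrow> q i = q k" if "i \<in> C" "k \<in> C" for i k
    proof -
      have "even (Q i)" "even (Q k)" using True that by auto
      then show ?thesis unfolding b_def q_def by presburger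
    qed
    have A: "\<not> (p i \<noteq> p k \<and> q i = q k)" if "i \<in> C" "k \<in> C" "i \<noteq> k" for i k
      using no_pair[OF that] a_p b_q that by blast
    have B: "\<not> ((p i = p k) = (p l = p m) \<and> (q i = q k) = (q l = q m))"
      if "i \<in> C" "k \<in> C" "l \<in> C" "m \<in> C" "i \<noteq> k" "l \<noteq> m" "{i, k} \<inter> {l, m} = {}" for i k l m
      using no_quad[OF that] a_p b_q that by blast
    show ?thesis
      using quadruple_or_pair_even[of "p x1" "p x2" "q x1" "q x2" "p x3" "q x3" "p x4" "q x4" "p x5" "q x5"]
      by (simp only: FF
        A[OF xs(1,2) ne(1)] A[OF xs(1,3) ne(2)] A[OF xs(1,4) ne(3)] A[OF xs(1,5) ne(4)] A[OF xs(2,3) ne(5)]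
        A[OF xs(2,4) ne(6)] A[OF xs(2,5) ne(7)] A[OF xs(3,4) ne(8)] A[OF xs(3,5) ne(9)] A[OF xs(4,5) ne(10)]
        B[OF xs(1,2,3,4) ne(1,8) disj(1)] B[OF xs(1,2,3,5) ne(1,9) disj(2)] B[OF xs(1,2,4,5) ne(1,10) disj(3)]
        B[OF xs(1,3,4,5) ne(2,10) disj(4)] B[OF xs(2,3,4,5) ne(5,10) disj(5)])
  next
    case False
    then have odd: "\<forall>i\<in>C. odd (Q i)" using par by blast
    have b_q: "b i k \<longleftrightarrow> q i \<noteq> q k" if "i \<in> C" "k \<in> C" for i k
    proof -
      have "odd (Q i)" "odd (Q k)" using odd that by auto
      then show ?thesis unfolding b_def q_def by presburger
    qed
    have A: "\<not> (p i \<noteq> p k \<and> q i \<noteq> q k)" if "i \<in> C" "k \<in> C" "i \<noteq> k" for i k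
      using no_pair[OF that] a_p b_q that by blast
    have B: "\<not> ((p i = p k) = (p l = p m) \<and> (q i = q k) = (q l = q m))"
      if "i \<in> C" "k \<in> C" "l \<in> C" "m \<in> C" "i \<noteq> k" "l \<noteq> m" "{i, k} \<inter> {l, m} = {}" for i k l m
      using no_quad[OF that] a_p b_q that by blast
    show ?thesis
      using quadruple_or_pair_odd[of "p x1" "p x2" "q x1" "q x2" "p x3" "q x3" "p x4" "q x4" "p x5" "q x5"]
      by (simp only: FF
        A[OF xs(1,2) ne(1)] A[OF xs(1,3) ne(2)] A[OF xs(1,4) ne(3)] A[OF xs(1,5) ne(4)] A[OF xs(2,3) ne(5)]
        A[OF xs(2,4) ne(6)] A[OF xs(2,5) ne(7)] A[OF xs(3,4) ne(8)] A[OF xs(3,5) ne(9)] A[OF xs(4,5) ne(10)]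
        B[OF xs(1,2,3,4) ne(1,8) disj(1)] B[OF xs(1,2,3,5) ne(1,9) disj(2)] B[OF xs(1,2,4,5) ne(1,10) disj(3)]
        B[OF xs(1,3,4,5) ne(2,10) disj(4)] B[OF xs(2,3,4,5) ne(5,10) disj(5)])
  qed
qed

lemma same_parity_two_pairs:
  assumes C: "card C \<ge> 4" "\<And>i. i \<in> C \<Longrightarrow> odd (P i)"
    and par: "(\<forall>i\<in>C. even (Q i)) \<or> (\<forall>i\<in>C. odd (Q i))"
  shows "\<exists>U1 U2 a1 b1 a2 b2. U1 \<subseteq> C \<and> U2 \<subseteq> C \<and> U1 \<inter> U2 = {} \<and> card U1 = 2 \<and> card U2 = 2
    \<and> cls U1 a1 b1 \<and> cls U2 a2 b2"
proof -
  obtain i k where ik: "i \<in> C" "k \<in> C" "i \<noteq> k" using C(1) by (elim card_ge_2_obtain[of C, rotated]) auto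
  have "card (C - {i, k}) \<ge> 2" using card_Diff_ge[of "{i, k}" C] ik C(1) by simp
  then obtain l m where lm: "l \<in> C - {i, k}" "m \<in> C - {i, k}" "l \<noteq> m" by (rule card_ge_2_obtain)
  have "cls {i, k} (4 dvd P i + P k) (4 dvd Q i + Q k)" "cls {l, m} (4 dvd P l + P m) (4 dvd Q l + Q m)"
    using ik lm C(2) par by (auto intro!: cls_pair)
  moreover have "card {i, k} = 2" "card {l, m} = 2" "{i, k} \<inter> {l, m} = {}" "{i, k} \<subseteq> C" "{l, m} \<subseteq> C"
    using ik lm by auto
  ultimately show ?thesis by blast
qed

lemma reach_mono: "reach S a b \<Longrightarrow> S \<subseteq> S' \<Longrightarrow> reach S' a b"
  unfolding reach_def by blast

text \<open>Five units with the same parity of \<open>Q\<close> are enough. Otherwise there are four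
  of each parity, hence four disjoint pairs; with only three nonzero classes, one pair has class
  zero or two pairs have equal classes.\<close>

lemma eight_units_reach:
  assumes S: "card S \<ge> 8" "\<And>i. i \<in> S \<Longrightarrow> odd (P i)"
  shows "reach S True True"
proof -
  define C where "C = {i \<in> S. even (Q i)}"
  define D where "D = {i \<in> S. odd (Q i)}"
  have fin: "finite S" using S(1) by (metis card.infinite not_numeral_le_zero)
  have sub: "C \<subseteq> S" "D \<subseteq> S" "C \<inter> D = {}" by (auto simp: C_def D_def)
  have "S = C \<union> D" by (auto simp: C_def D_def)
  then have "card C + card D = card S" using sub fin by (metis card_Un_disjoint finite_Un)
  have CD: "\<And>i. i \<in> C \<Longrightarrow> odd (P i)" "\<forall>i\<in>C. even (Q i)" "\<And>i. i \<in> D \<Longrightarrow> odd (P i)" "\<forall>i\<in>D. odd (Q i)"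
    using S(2) by (auto simp: C_def D_def)
  from \<open>card C + card D = card S\<close> consider "card C \<ge> 5" | "card D \<ge> 5" | "card C \<ge> 4" "card D \<ge> 4" using S(1) by linarith
  then show ?thesis
  proof cases
    case 1
    then have "reach C True True" using five_units_reach[OF _ CD(1)] CD(2) by blast
    then show ?thesis using sub reach_mono by blast
  next
    case 2
    then have "reach D True True" using five_units_reach[OF _ CD(3)] CD(4) by blast
    then show ?thesis using sub reach_mono by blast
  next
    case 3
    obtain U1 U2 a1 b1 a2 b2 where U: "U1 \<subseteq> C" "U2 \<subseteq> C" "U1 \<inter> U2 = {}" "card U1 = 2" "card U2 = 2"
      "cls U1 a1 b1" "cls U2 a2 b2"
      using same_parity_two_pairs[OF 3(1) CD(1) disjI1[OF CD(2)]] by blast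
    obtain V1 V2 c1 d1 c2 d2 where V: "V1 \<subseteq> D" "V2 \<subseteq> D" "V1 \<inter> V2 = {}" "card V1 = 2" "card V2 = 2"
      "cls V1 c1 d1" "cls V2 c2 d2"
      using same_parity_two_pairs[OF 3(2) CD(3) disjI2[OF CD(4)]] by blast
    note US = order_trans[OF U(1) sub(1)] order_trans[OF U(2) sub(1)]
    note VS = order_trans[OF V(1) sub(2)] order_trans[OF V(2) sub(2)]
    have UV: "U1 \<inter> V1 = {}" "U1 \<inter> V2 = {}" "U2 \<inter> V1 = {}" "U2 \<inter> V2 = {}"
      using U V sub(3) by blast+
    have R: "reach S a1 b1" "reach S a2 b2" "reach S c1 d1" "reach S c2 d2"
      by (rule reachI[OF US(1) U(4,6)] reachI[OF US(2) U(5,7)] reachI[OF VS(1) V(4,6)] reachI[OF VS(2) V(5,7)])+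
    have R2: "reach S (a1 = a2) (b1 = b2)" "reach S (c1 = c2) (d1 = d2)"
      "reach S (a1 = c1) (b1 = d1)" "reach S (a1 = c2) (b1 = d2)" "reach S (a2 = c1) (b2 = d1)" "reach S (a2 = c2) (b2 = d2)"
      by (rule reach_Un[OF US U(3-7)] reach_Un[OF VS V(3-7)]
        reach_Un[OF US(1) VS(1) UV(1) U(4) V(4) U(6) V(6)] reach_Un[OF US(1) VS(2) UV(2) U(4) V(5) U(6) V(7)]
        reach_Un[OF US(2) VS(1) UV(3) U(5) V(4) U(7) V(6)] reach_Un[OF US(2) VS(2) UV(4) U(5) V(5) U(7) V(7)])+
    have "(a1 \<and> b1) \<or> (a2 \<and> b2) \<or> (c1 \<and> d1) \<or> (c2 \<and> d2) \<or> (a1 = a2 \<and> b1 = b2) \<or> (c1 = c2 \<and> d1 = d2)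
      \<or> (a1 = c1 \<and> b1 = d1) \<or> (a1 = c2 \<and> b1 = d2) \<or> (a2 = c1 \<and> b2 = d1) \<or> (a2 = c2 \<and> b2 = d2)"
      by (cases a1; cases b1; cases a2; cases b2; simp; cases c1; cases d1; cases c2; cases d2; simp)
    moreover have "reach S True True" if "reach S a b" "a \<and> b" for a b using that by simp
    ultimately show ?thesis using R R2 by (elim disjE) metis+
  qed
qed

text \<open>The levels of \<open>P i + Q i w\<close>.\<close>

definition lev0 :: "'a set \<Rightarrow> 'a set" where "lev0 I = {i \<in> I. odd (P i)}"
definition lev1 :: "'a set \<Rightarrow> 'a set" where "lev1 I = {i \<in> I. even (P i) \<and> odd (Q i)}"
definition lev2 :: "'a set \<Rightarrow> 'a set" where "lev2 I = {i \<in> I. P i mod 4 = 2 \<and> even (Q i)}"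
definition lev3 :: "'a set \<Rightarrow> 'a set" where "lev3 I = {i \<in> I. P i mod 4 = 0 \<and> Q i mod 4 = 2}"

text \<open>The two alternatives are the hypotheses of \<open>approx_zero_mixed_levels\<close> and
  \<open>approx_zero_spare_units\<close> in terms of coordinates.\<close>

definition solvable :: "'a set \<Rightarrow> bool" where
  "solvable I \<longleftrightarrow> (\<exists>U\<subseteq>I. cls U True True \<and> U \<inter> lev0 I \<noteq> {} \<and>
     (lev0 I - U \<noteq> {} \<and> (U \<inter> lev1 I \<noteq> {} \<or> lev2 I - U \<noteq> {}) \<or> 3 \<le> card (lev0 I - U)))"

lemma solvableI:
  assumes "U \<subseteq> lev0 I" "U \<noteq> {}" "W \<subseteq> I - lev0 I" "cls (U \<union> W) True True"
    and "lev0 I - U \<noteq> {} \<and> (W \<inter> lev1 I \<noteq> {} \<or> lev2 I - W \<noteq> {}) \<or> 3 \<le> card (lev0 I - U)"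
  shows "solvable I"
proof -
  have lev0: "lev0 I \<subseteq> I" by (auto simp: lev0_def)
  have "i \<notin> lev0 I" if "i \<in> lev2 I" for i
  proof -
    have "P i mod 4 = 2" using that by (simp add: lev2_def)
    then have "even (P i)" by presburger
    then show ?thesis by (simp add: lev0_def)
  qed
  then have e2: "lev2 I - (U \<union> W) = lev2 I - W" using assms(1) by blast
  have e0: "lev0 I - (U \<union> W) = lev0 I - U" using assms(3) by blast
  have "U \<union> W \<subseteq> I" using lev0 assms(1,3) by blast
  moreover have "(U \<union> W) \<inter> lev0 I \<noteq> {}" using assms(1,2) by blast
  moreover have "lev0 I - (U \<union> W) \<noteq> {} \<and> ((U \<union> W) \<inter> lev1 I \<noteq> {} \<or> lev2 I - (U \<union> W) \<noteq> {})
      \<or> 3 \<le> card (lev0 I - (U \<union> W))"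
    unfolding e0 e2 using assms(5) by blast
  ultimately show ?thesis unfolding solvable_def using assms(4) by blast
qed

section \<open>Level counts that guarantee solvability\<close>

lemma cls_empty: "cls {} True True" by (simp add: cls_def)

lemma lev2_cl: "i \<in> lev2 I \<Longrightarrow> cls {i} False (4 dvd Q i)"
  unfolding lev2_def cls_def by auto presburger+

lemma lev3_cl: "i \<in> lev3 I \<Longrightarrow> cls {i} True False"
  unfolding lev3_def cls_def by auto presburger+

lemma lev_disj: "i \<in> lev1 I \<or> i \<in> lev2 I \<or> i \<in> lev3 I \<Longrightarrow> i \<in> I - lev0 I"
  unfolding lev0_def lev1_def lev2_def lev3_def by auto presburger+

lemma lev0_odd: "i \<in> lev0 I \<Longrightarrow> odd (P i)" by (simp add: lev0_def)

lemma lev_ne: "i \<in> lev2 I \<Longrightarrow> k \<in> lev3 I \<Longrightarrow> i \<noteq> k"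
  unfolding lev2_def lev3_def by auto

lemma card_diff_pos: "card A > card B \<Longrightarrow> finite B \<Longrightarrow> A - B \<noteq> {}"
  by (metis Diff_eq_empty_iff card_mono not_less)

lemma card_2_ne: "card U = 2 \<Longrightarrow> U \<noteq> {}" by auto

text \<open>The subsets of \<open>{y, z}\<close> realise all four classes, so one of them cancels
  the class of a pair of units. The third unit and \<open>y'\<close> remain for the later
  digits.\<close>

lemma solvable_3021:
  assumes "card (lev0 I) \<ge> 3" "card (lev2 I) \<ge> 2" "card (lev3 I) \<ge> 1"
  shows "solvable I"
proof -
  obtain U a b where U: "U \<subseteq> lev0 I" "card U = 2" "cls U a b"
    using unit_pair[of "lev0 I"] assms(1) lev0_odd by metis
  obtain y y' where y: "y \<in> lev2 I" "y' \<in> lev2 I" "y \<noteq> y'" using card_ge_2_obtain assms(2) by metis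
  obtain z where z: "z \<in> lev3 I" using assms(3) by (metis card.empty equals0I not_one_le_zero)
  have left: "lev0 I - U \<noteq> {}" using U assms(1) cls_finite card_diff_pos[of U "lev0 I"] by fastforce
  have main: "solvable I" if "W \<subseteq> {y, z}" "cls W a' b'" "a' = a" "b' = b" for W a' b'
  proof (rule solvableI[OF U(1) card_2_ne[OF U(2)]])
    show 1: "W \<subseteq> I - lev0 I" using that(1) lev_disj y z by blast
    have "cls W a b" using that by simp
    then show "cls (U \<union> W) True True" using cls_Un_eq[OF U(3)] 1 U(1) by blast
    show "lev0 I - U \<noteq> {} \<and> (W \<inter> lev1 I \<noteq> {} \<or> lev2 I - W \<noteq> {}) \<or> 3 \<le> card (lev0 I - U)"
      using left y z that(1) lev_ne[OF y(2) z] by blast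
  qed
  define c where "c \<longleftrightarrow> 4 dvd Q y"
  have cy: "cls {y} False c" using lev2_cl[OF y(1)] by (simp add: c_def)
  have zy: "cls ({z} \<union> {y}) False (\<not> c)"
    using cls_Un[OF lev3_cl[OF z] cy] lev_ne[OF y(1) z] by simp
  show ?thesis
    using main[OF _ cls_empty] main[OF _ cy] main[OF _ lev3_cl[OF z]] main[OF _ zy]
    by (cases a; cases b; cases c) simp_all
qed

lemma solvable_combine:
  assumes "U \<subseteq> lev0 I" "U \<noteq> {}" "cls U a b" "W \<subseteq> I - lev0 I" "cls W a' b'" "a' = a" "b' = b"
    and "card U < card (lev0 I) \<and> (W \<inter> lev1 I \<noteq> {} \<or> lev2 I - W \<noteq> {}) \<or> card U + 3 \<le> card (lev0 I)"
  shows "solvable I"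
proof (rule solvableI[OF assms(1,2,4)])
  have fin: "finite U" using assms(3) by (rule cls_finite)
  have "cls W a b" using assms(5-7) by simp
  then show "cls (U \<union> W) True True" using cls_Un_eq[OF assms(3)] assms(1,4) by blast
  show "lev0 I - U \<noteq> {} \<and> (W \<inter> lev1 I \<noteq> {} \<or> lev2 I - W \<noteq> {}) \<or> 3 \<le> card (lev0 I - U)"
    using assms(8) card_diff_pos[of U "lev0 I"] card_Diff_ge[OF fin, of "lev0 I"] fin by auto
qed

lemma solvable_reach:
  assumes "reach (lev0 I) a b" "W \<subseteq> I - lev0 I" "cls W a' b'" "a' = a" "b' = b"
    and "card (lev0 I) \<ge> 5 \<and> (W \<inter> lev1 I \<noteq> {} \<or> lev2 I - W \<noteq> {}) \<or> card (lev0 I) \<ge> 7"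
  shows "solvable I"
proof -
  obtain U where U: "U \<subseteq> lev0 I" "U \<noteq> {}" "card U \<le> 4" "cls U a b"
    using assms(1) unfolding reach_def by blast
  show ?thesis
    by (rule solvable_combine[OF U(1,2,4) assms(2-5)]) (use U(3) assms(6) in auto)
qed

lemma lev_sub: "lev1 I \<subseteq> I - lev0 I" "lev2 I \<subseteq> I - lev0 I" "lev3 I \<subseteq> I - lev0 I"
  using lev_disj by blast+

lemma lev_singleton: "y \<in> lev2 I \<or> y \<in> lev3 I \<Longrightarrow> {y} \<subseteq> I - lev0 I"
  using lev_disj by blast

lemma card_ge_1_obtain: assumes "card S \<ge> 1" obtains i where "i \<in> S"
  using assms by (metis card.empty equals0I not_one_le_zero)

lemma lev0_reach:
  assumes "card (lev0 I) \<ge> 5"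
  shows "reach (lev0 I) True True \<or> (reach (lev0 I) True False \<and> reach (lev0 I) False True \<and> reach (lev0 I) False False)"
    and "reach (lev0 I) True False \<or> reach (lev0 I) False True \<or> reach (lev0 I) False False"
  by (rule unit_reach[OF assms], erule lev0_odd)+

lemma solvable_8000:
  assumes "card (lev0 I) \<ge> 8"
  shows "solvable I"
proof -
  have "reach (lev0 I) True True" by (rule eight_units_reach[OF assms], erule lev0_odd)
  then show ?thesis by (rule solvable_reach[OF _ _ cls_empty]) (use assms in auto)
qed

lemma solvable_7001:
  assumes "card (lev0 I) \<ge> 7" "card (lev3 I) \<ge> 1"
  shows "solvable I"
proof -
  obtain z where z: "z \<in> lev3 I" using assms(2) by (rule card_ge_1_obtain)
  have "reach (lev0 I) True True \<or> reach (lev0 I) True False"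
    using lev0_reach(1)[of I] assms(1) by auto
  then show ?thesis
  proof
    assume "reach (lev0 I) True True"
    then show ?thesis by (rule solvable_reach[OF _ _ cls_empty]) (use assms in auto)
  next
    assume "reach (lev0 I) True False"
    then show ?thesis by (rule solvable_reach[OF _ lev_singleton lev3_cl[OF z]]) (use assms z in auto)
  qed
qed

lemma solvable_5011:
  assumes "card (lev0 I) \<ge> 5" "card (lev2 I) \<ge> 1" "card (lev3 I) \<ge> 1"
  shows "solvable I"
proof -
  obtain z where z: "z \<in> lev3 I" using assms(3) by (rule card_ge_1_obtain)
  obtain y where y: "y \<in> lev2 I" using assms(2) by (rule card_ge_1_obtain)
  have "reach (lev0 I) True True \<or> reach (lev0 I) True False"
    using lev0_reach(1)[OF assms(1)] by blast
  then show ?thesis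
  proof
    assume "reach (lev0 I) True True"
    then show ?thesis by (rule solvable_reach[OF _ _ cls_empty]) (use assms y in auto)
  next
    assume "reach (lev0 I) True False"
    then show ?thesis by (rule solvable_reach[OF _ lev_singleton lev3_cl[OF z]]) (use assms z y lev_ne[OF y z] in auto)
  qed
qed

text \<open>The units reach either zero or the class of \<open>y\<close>, which \<open>y\<close>
  then cancels; \<open>y'\<close> stays outside for the last digit.\<close>

lemma solvable_5020:
  assumes "card (lev0 I) \<ge> 5" "card (lev2 I) \<ge> 2"
  shows "solvable I"
proof -
  obtain y y' where y: "y \<in> lev2 I" "y' \<in> lev2 I" "y \<noteq> y'" using card_ge_2_obtain[OF assms(2)] by metis
  have "reach (lev0 I) True True \<or> reach (lev0 I) False (4 dvd Q y)"
    using lev0_reach(1)[OF assms(1)] by (cases "4 dvd Q y") auto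
  then show ?thesis
  proof
    assume "reach (lev0 I) True True"
    then show ?thesis by (rule solvable_reach[OF _ _ cls_empty]) (use assms y in auto)
  next
    assume "reach (lev0 I) False (4 dvd Q y)"
    then show ?thesis by (rule solvable_reach[OF _ lev_singleton lev2_cl[OF y(1)]]) (use assms y in auto)
  qed
qed

lemma reach_lev1_solvable:
  assumes "reach (lev0 I) a b" "reach (lev1 I) a' b'" "a' = a" "b' = b" "card (lev0 I) \<ge> 5"
  shows "solvable I"
proof -
  obtain W where W: "W \<subseteq> lev1 I" "W \<noteq> {}" "cls W a' b'"
    using assms(2) unfolding reach_def by blast
  have "W \<inter> lev1 I \<noteq> {}" using W by blast
  moreover have "W \<subseteq> I - lev0 I" using W(1) lev_sub(1) by (rule order_trans)
  ultimately show ?thesis using assms solvable_reach[OF assms(1) _ W(3) assms(3,4)] by blast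
qed

lemma lev1_par: "i \<in> lev1 I \<Longrightarrow> even (P i) \<and> odd (Q i)"
  by (simp add: lev1_def)

text \<open>Each of the two levels reaches zero or all nonzero classes, and in any case some nonzero
  class. Hence both reach a common class. The level-1 part is nonempty even for class zero, as the
  last digit demands.\<close>

lemma solvable_5400:
  assumes "card (lev0 I) \<ge> 5" "card (lev1 I) \<ge> 4"
  shows "solvable I"
proof -
  have 1: "reach (lev0 I) True True \<or> (reach (lev0 I) True False \<and> reach (lev0 I) False True \<and> reach (lev0 I) False False)"
    and 2: "reach (lev0 I) True False \<or> reach (lev0 I) False True \<or> reach (lev0 I) False False"
    by (rule lev0_reach[OF assms(1)])+
  have 3: "reach (lev1 I) True True \<or> (reach (lev1 I) True False \<and> reach (lev1 I) False True \<and> reach (lev1 I) False False)"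
    by (rule level1_reach[OF assms(2)], erule lev1_par)
  obtain a b where 4: "(a, b) \<noteq> (True, True)" "reach (lev1 I) a b"
    using level1_triple[of "lev1 I" True] lev1_par[of _ I] assms(2) by auto
  then have 4: "reach (lev1 I) True False \<or> reach (lev1 I) False True \<or> reach (lev1 I) False False"
    by (cases a; cases b) auto
  have main: "solvable I" if "reach (lev0 I) a b" "reach (lev1 I) a b" for a b
    using reach_lev1_solvable[OF that] assms(1) by simp
  show ?thesis using 1 2 3 4 main[of True True] main[of True False] main[of False True] main[of False False]
    by blast
qed

text \<open>Three vectors in a plane over the field of two elements are linearly dependent, so some
  nonempty union of three disjoint pairs has class zero. It takes at most six units; the seventh and
  \<open>y\<close> are left over.\<close>

lemma solvable_7010:
  assumes "card (lev0 I) \<ge> 7" "card (lev2 I) \<ge> 1"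
  shows "solvable I"
proof -
  obtain y where y: "y \<in> lev2 I" using assms(2) by (rule card_ge_1_obtain)
  obtain U1 U2 U3 a1 b1 a2 b2 a3 b3 where U: "U1 \<subseteq> lev0 I" "U2 \<subseteq> lev0 I" "U3 \<subseteq> lev0 I"
    and D: "U1 \<inter> U2 = {}" "U1 \<inter> U3 = {}" "U2 \<inter> U3 = {}"
    and C: "card U1 = 2" "card U2 = 2" "card U3 = 2"
    and cl: "cls U1 a1 b1" "cls U2 a2 b2" "cls U3 a3 b3"
    using three_unit_pairs[OF assms(1)] lev0_odd[of _ I] by metis
  have main: "solvable I" if "U \<subseteq> lev0 I" "U \<noteq> {}" "cls U a b" "a" "b" "card U \<le> 6" for U a b
    by (rule solvable_combine[OF that(1-3) _ cls_empty]) (use that assms y in auto)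
  note fin = cls_finite[OF cl(1)] cls_finite[OF cl(2)] cls_finite[OF cl(3)]
  have ne: "U1 \<noteq> {}" "U2 \<noteq> {}" using C by auto
  have D3: "(U1 \<union> U2) \<inter> U3 = {}" using D by blast
  have c12: "card (U1 \<union> U2) \<le> 6" "card (U1 \<union> U2 \<union> U3) \<le> 6"
    using fin C D D3 by (auto simp: card_Un_disjoint)
  have c13: "card (U1 \<union> U3) \<le> 6" "card (U2 \<union> U3) \<le> 6" using fin C D by (auto simp: card_Un_disjoint)
  note m = main[OF U(1) ne(1) cl(1)] main[OF U(2) ne(2) cl(2)] main[OF U(3) _ cl(3)]
    main[OF _ _ cls_Un[OF cl(1,2) D(1)]] main[OF _ _ cls_Un[OF cl(1,3) D(2)]] main[OF _ _ cls_Un[OF cl(2,3) D(3)]]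
    main[OF _ _ cls_Un[OF cls_Un[OF cl(1,2) D(1)] cl(3) D3]]
  have M1: "solvable I" if "a1" "b1" by (rule m(1)[OF that]) (simp add: C)
  have M2: "solvable I" if "a2" "b2" by (rule m(2)[OF that]) (simp add: C)
  have M3: "solvable I" if "a3" "b3" by (rule m(3)[OF _ that]) (use C in auto)
  have M4: "solvable I" if "a1 = a2" "b1 = b2" by (rule m(4)[OF _ _ that]) (use U ne c12 in auto)
  have M5: "solvable I" if "a1 = a3" "b1 = b3" by (rule m(5)[OF _ _ that]) (use U ne c13 in auto)
  have M6: "solvable I" if "a2 = a3" "b2 = b3" by (rule m(6)[OF _ _ that]) (use U ne c13 in auto)
  have M7: "solvable I" if "(a1 = a2) = a3" "(b1 = b2) = b3" by (rule m(7)[OF _ _ that]) (use U ne c12 in auto)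
  have "(a1 \<and> b1) \<or> (a2 \<and> b2) \<or> (a3 \<and> b3) \<or> (a1 = a2 \<and> b1 = b2) \<or> (a1 = a3 \<and> b1 = b3) \<or> (a2 = a3 \<and> b2 = b3)
     \<or> ((a1 = a2) = a3 \<and> (b1 = b2) = b3)"
    by (cases a1; cases b1; cases a2; cases b2; cases a3; cases b3; simp)
  then show ?thesis using M1 M2 M3 M4 M5 M6 M7 by blast
qed

text \<open>If the class of the unit pair is zero, nothing is added. If it is the class of
  \<open>y\<close>, level 1 supplies it or supplies zero, and \<open>y\<close> is added. Otherwise
  it lies outside the subgroup of order two generated by the class of \<open>y\<close>; so does some
  class from \<open>level1_triple\<close>, and the two agree after possibly adding
  \<open>y\<close>.\<close>

lemma solvable_3410:
  assumes "card (lev0 I) \<ge> 3" "card (lev1 I) \<ge> 4" "card (lev2 I) \<ge> 1"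
  shows "solvable I"
proof -
  obtain y where y: "y \<in> lev2 I" using assms(3) by (rule card_ge_1_obtain)
  obtain U a b where U: "U \<subseteq> lev0 I" "card U = 2" "cls U a b"
    using unit_pair[OF assms(1)] lev0_odd[of _ I] by metis
  have ne: "U \<noteq> {}" using U(2) by auto
  define c where "c \<longleftrightarrow> 4 dvd Q y"
  have cy: "cls {y} False c" using lev2_cl[OF y] by (simp add: c_def)
  have zero: "solvable I" if "a" "b"
    by (rule solvable_combine[OF U(1) ne U(3) _ cls_empty]) (use that U(2) assms y in auto)
  have yW: "y \<notin> lev1 I" using y by (auto simp: lev1_def lev2_def)
  have one: "solvable I" if r: "reach (lev1 I) a' b'" and "a' = a" "b' = b" for a' b'
  proof -
    obtain W where W: "W \<subseteq> lev1 I" "W \<noteq> {}" "cls W a' b'" using r unfolding reach_def by blast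
    show ?thesis
      by (rule solvable_combine[OF U(1) ne U(3) order_trans[OF W(1) lev_sub(1)] W(3) that(2,3)])
        (use W U(2) assms in auto)
  qed
  have two: "solvable I" if r: "reach (lev1 I) a' b'" and "(a' = False) = a" "(b' = c) = b" for a' b'
  proof -
    obtain W where W: "W \<subseteq> lev1 I" "W \<noteq> {}" "cls W a' b'" using r unfolding reach_def by blast
    have "cls (W \<union> {y}) (a' = False) (b' = c)" using cls_Un[OF W(3) cy] W(1) yW by blast
    moreover have "W \<union> {y} \<subseteq> I - lev0 I" using W(1) y lev_sub by blast
    ultimately show ?thesis
      by (intro solvable_combine[OF U(1) ne U(3) _ _ that(2,3)]) (use W U(2) assms in auto)
  qed
  consider "a" "b" | "\<not> a" "b = c" | "\<not> (a \<and> b)" "\<not> (\<not> a \<and> b = c)" by blast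
  then show ?thesis
  proof cases
    case 1
    then show ?thesis by (rule zero)
  next
    case 2
    have "reach (lev1 I) True True \<or> reach (lev1 I) False c"
      using level1_reach[OF assms(2)] lev1_par[of _ I] by (cases c) auto
    then show ?thesis
    proof
      assume "reach (lev1 I) True True"
      then show ?thesis by (rule two) (use 2 in auto)
    next
      assume "reach (lev1 I) False c"
      then show ?thesis by (rule one) (use 2 in auto)
    qed
  next
    case 3
    have "\<exists>a b. (a, b) \<noteq> (True, True) \<and> (a, b) \<noteq> (False, c) \<and> reach (lev1 I) a b"
      using assms(2) by (intro level1_triple lev1_par) auto
    then obtain a' b' where ab: "(a', b') \<noteq> (True, True)" "(a', b') \<noteq> (False, c)" "reach (lev1 I) a' b'"
      by blast
    have "(a' = a \<and> b' = b) \<or> ((a' = False) = a \<and> (b' = c) = b)"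
      using 3 ab(1,2) by (cases a; cases b; cases a'; cases b'; cases c; simp)
    then show ?thesis using one[OF ab(3)] two[OF ab(3)] by blast
  qed
qed

end

section \<open>Level counts\<close>

text \<open>The lemma \<open>solvable_klmn\<close> settles the disjunct with lower bounds \<open>k, l, m, n\<close>.\<close>

definition fits :: "nat \<Rightarrow> nat \<Rightarrow> nat \<Rightarrow> nat \<Rightarrow> bool" where
  "fits a b c e \<longleftrightarrow> (a \<ge> 3 \<and> c \<ge> 2 \<and> e \<ge> 1) \<or> (a \<ge> 5 \<and> c \<ge> 1 \<and> e \<ge> 1) \<or> (a \<ge> 5 \<and> c \<ge> 2)
    \<or> (a \<ge> 3 \<and> b \<ge> 4 \<and> c \<ge> 1) \<or> (a \<ge> 7 \<and> c \<ge> 1) \<or> (a \<ge> 5 \<and> b \<ge> 4) \<or> (a \<ge> 7 \<and> e \<ge> 1) \<or> a \<ge> 8"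

text \<open>With the first count maximal, only a few counts survive the failure of
  \<open>fits a b c e\<close>; these are excluded by the other rotations.\<close>

lemma fits_max:
  assumes "a + b + c + e \<ge> 11" "a \<ge> b" "a \<ge> c" "a \<ge> e"
  shows "fits a b c e \<or> fits b c e a \<or> fits c e a b \<or> fits e a b c"
proof (rule ccontr)
  assume "\<not> ?thesis"
  then have n: "\<not> fits a b c e" "\<not> fits b c e a" "\<not> fits c e a b" "\<not> fits e a b c" by auto
  have a: "a \<ge> 3" "a < 8" using n(1) assms by (auto simp: fits_def)
  show False
  proof (cases "c \<ge> 2")
    case True
    then have "e = 0" "a < 5" "b < 4" using n(1) a by (auto simp: fits_def)
    \<comment> \<open>The counts (4, 3, 4, 0) remain, and \<open>fits c e a b\<close> holds for them
      by its first disjunct.\<close>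
    then have "b = 3" "a = 4" "c = 4" using assms by auto
    then show False using n \<open>e = 0\<close> by (simp add: fits_def)
  next
    case c: False
    show False
    proof (cases "c = 1")
      case True
      then have *: "b < 4" "a < 7" "a \<ge> 5 \<Longrightarrow> e = 0" using n(1) a by (auto simp: fits_def)
      have "a < 5" using *(1,2) *(3) assms True by (cases "a < 5") auto
      \<comment> \<open>Here \<open>fits e a b c\<close> holds by its first disjunct.\<close>
      then have "a = 4" "e = 4 \<or> e = 3" "b \<ge> 2" using *(1) assms True by linarith+
      then show False using n True * by (auto simp: fits_def)
    next
      case False
      then have c: "c = 0" using c by simp
      have *: "a \<ge> 5 \<Longrightarrow> b < 4" "a \<ge> 7 \<Longrightarrow> e = 0" using n(1) a by (auto simp: fits_def)
      have **: "b \<ge> 3 \<Longrightarrow> e < 2" using n(2) a by (auto simp: fits_def)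
      have ***: "e \<ge> 3 \<Longrightarrow> a \<ge> 4 \<Longrightarrow> b = 0" using n(4) a by (auto simp: fits_def)
      have "e < 5" using n(4) assms by (auto simp: fits_def)
      then have "b \<ge> 1" "a \<ge> 4" using * a assms c by fastforce+
      then have "e < 3" using *** by fastforce
      then have "b \<ge> 3" using * a assms c by fastforce
      \<comment> \<open>Now \<open>e < 2\<close>. Either \<open>a = 4\<close>, or
        \<open>b < 4\<close> with \<open>e = 0\<close> once \<open>a\<close> reaches 7; in each case
        the total is at most 10.\<close>
      then show False using * ** a assms c by fastforce
    qed
  qed
qed

lemma fits_rotation:
  assumes "a + b + c + e \<ge> 11"
  shows "fits a b c e \<or> fits b c e a \<or> fits c e a b \<or> fits e a b c"
proof -
  consider "a \<ge> b" "a \<ge> c" "a \<ge> e" | "b \<ge> c" "b \<ge> e" "b \<ge> a" | "c \<ge> e" "c \<ge> a" "c \<ge> b" | "e \<ge> a" "e \<ge> b" "e \<ge> c"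
    by linarith
  then show ?thesis
  proof cases
    case 1 then show ?thesis using fits_max[of a b c e] assms by simp
  next
    case 2 then have "fits b c e a \<or> fits c e a b \<or> fits e a b c \<or> fits a b c e" using assms by (intro fits_max) auto
    then show ?thesis by blast
  next
    case 3 then have "fits c e a b \<or> fits e a b c \<or> fits a b c e \<or> fits b c e a" using assms by (intro fits_max) auto
    then show ?thesis by blast
  next
    case 4 then have "fits e a b c \<or> fits a b c e \<or> fits b c e a \<or> fits c e a b" using assms by (intro fits_max) auto
    then show ?thesis by blast
  qed
qed

context coordinates begin

lemma solvable_if_fits:
  "fits (card (lev0 I)) (card (lev1 I)) (card (lev2 I)) (card (lev3 I)) \<Longrightarrow> solvable I"
  unfolding fits_def
  using solvable_3021 solvable_5011 solvable_5020 solvable_3410 solvable_7010 solvable_5400 solvable_7001 solvable_8000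
  by meson

end

section \<open>The two bounds\<close>

context ramified begin

text \<open>For odd \<open>c\<close> the number \<open>1 - c * c\<close> is divisible by 4, so
  \<open>c\<close> serves as the inverse of the denominator modulo \<open>w ^ 4\<close>.\<close>

lemma coordinates_mod_4:
  assumes "x \<in> J 0"
  shows "\<exists>p q. x - (of_int p + of_int q * w) \<in> J 4"
proof -
  obtain a b c where x: "x = (of_int a + of_int b * w) / of_int c" "odd c"
    using assms unfolding J_0 O_ring_def by blast
  have nz: "c \<noteq> 0" using x(2) by auto
  obtain k where "c = 2 * k + 1" using x(2) by (rule oddE)
  then have "1 - c * c = 4 * (- k * (k + 1))" by (simp add: algebra_simps)
  then obtain m where m: "1 - c * c = 4 * m" by blast
  have "(1 - of_int c * of_int c :: complex) = of_int (1 - c * c)" by simp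
  then have m': "(1 - of_int c * of_int c :: complex) = 4 * of_int m" unfolding m by simp
  have "x - (of_int (c * a) + of_int (c * b) * w) = (1 - of_int c * of_int c) * x"
    unfolding x(1) using nz by (simp add: field_simps)
  also have "\<dots> = 4 * of_int m * x" unfolding m' ..
  also have "\<dots> \<in> J (4 + 0 + 0)"
    using E_J[OF E_4 order_refl] assms by (intro J_mult) (auto simp: J_0)
  finally show ?thesis by (intro exI[of _ "c * a"] exI[of _ "c * b"]) simp
qed

lemma coord_int_J: "of_int q \<in> J 0" by (simp add: J_0)

lemma coord_even: "even q \<Longrightarrow> of_int q \<in> J 2"
  using J_mult[OF E_J[OF E_2 order_refl] coord_int_J] by (auto elim!: evenE)

lemma coord_four: "4 dvd q \<Longrightarrow> of_int q \<in> J 4"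
  using J_mult[OF E_J[OF E_4 order_refl] coord_int_J] by (auto elim!: dvdE)

lemma coord_two: "q mod 4 = 2 \<Longrightarrow> of_int q \<in> E 2"
proof -
  assume "q mod 4 = 2"
  then have "q = 2 * (q div 2)" "odd (q div 2)" by presburger+
  then have "of_int q = 2 * (of_int (q div 2) :: complex)" by (metis of_int_mult of_int_numeral)
  then show ?thesis using E_mult[OF E_2 E_odd[OF \<open>odd (q div 2)\<close>]] by simp
qed

lemma coord_w: "of_int q \<in> J k \<Longrightarrow> of_int q * w \<in> J (k + 1)"
  "of_int q \<in> E k \<Longrightarrow> of_int q * w \<in> E (k + 1)"
  using J_mult[OF _ E_J[OF E_w order_refl]] E_mult[OF _ E_w] by auto

lemma coord_level:
  fixes p q :: int
  defines "z \<equiv> of_int p + of_int q * w"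
  shows "odd p \<Longrightarrow> z \<in> E 0"
    and "even p \<Longrightarrow> odd q \<Longrightarrow> z \<in> E 1"
    and "p mod 4 = 2 \<Longrightarrow> even q \<Longrightarrow> z \<in> E 2"
    and "p mod 4 = 0 \<Longrightarrow> q mod 4 = 2 \<Longrightarrow> z \<in> E 3"
    and "4 dvd p \<Longrightarrow> 4 dvd q \<Longrightarrow> z \<in> J 4"
proof -
  show "odd p \<Longrightarrow> z \<in> E 0"
    unfolding z_def using coord_w(1)[OF coord_int_J, of q] by (intro E_add_J E_odd) auto
  show "z \<in> E 1" if "even p" "odd q"
  proof -
    have "of_int q * w + of_int p \<in> E 1"
      using coord_even[OF that(1)] coord_w(2)[OF E_odd[OF that(2)]] by (intro E_add_J) auto
    then show ?thesis by (simp add: z_def add.commute)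
  qed
  show "z \<in> E 2" if "p mod 4 = 2" "even q"
    unfolding z_def using coord_two[OF that(1)] coord_w(1)[OF coord_even[OF that(2)]] by (intro E_add_J) auto
  show "z \<in> E 3" if "p mod 4 = 0" "q mod 4 = 2"
  proof -
    have "of_int q * w + of_int p \<in> E 3"
      using coord_four[of p] coord_w(2)[OF coord_two[OF that(2)]] that by (intro E_add_J) auto
    then show ?thesis by (simp add: z_def add.commute)
  qed
  show "z \<in> J 4" if "4 dvd p" "4 dvd q"
    unfolding z_def using coord_four[OF that(1)] J_mono[OF _ coord_w(1)[OF coord_four[OF that(2)]], of 4]
    by (intro J_add) auto
qed

lemma level_cases:
  fixes p q :: int
  shows "odd p \<or> (even p \<and> odd q) \<or> (p mod 4 = 2 \<and> even q) \<or> (p mod 4 = 0 \<and> q mod 4 = 2) \<or> (4 dvd p \<and> 4 dvd q)"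
  by presburger

text \<open>Coordinates modulo \<open>w ^ 4\<close> determine every level below 4. The level counts
  therefore carry over to the combinatorial side, and its zero class becomes a sum in
  \<open>J 4\<close>.\<close>

lemma approx_zero_if_fits:
  fixes B :: "nat \<Rightarrow> complex"
  assumes fin: "finite I" and B: "\<And>i. i \<in> I \<Longrightarrow> \<exists>r\<in>{0, 1, 2, 3}. B i \<in> E r"
    and fits: "fits (card {i \<in> I. B i \<in> E 0}) (card {i \<in> I. B i \<in> E 1})
      (card {i \<in> I. B i \<in> E 2}) (card {i \<in> I. B i \<in> E 3})"
  shows "has_approx_zero I B"
proof -
  have "\<forall>i\<in>I. \<exists>p q. B i - (of_int p + of_int q * w) \<in> J 4"
  proof
    fix i assume "i \<in> I"
    then obtain r where "r \<in> {0, 1, 2, 3}" "B i \<in> E r" using B by blast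
    then have "B i \<in> J 0" using E_J[of "B i" r 0] by auto
    then show "\<exists>p q. B i - (of_int p + of_int q * w) \<in> J 4" by (rule coordinates_mod_4)
  qed
  then obtain P Q where PQ: "\<And>i. i \<in> I \<Longrightarrow> B i - (of_int (P i) + of_int (Q i) * w) \<in> J 4" by metis
  interpret coordinates P Q .
  have same: "B i \<in> E r" if "i \<in> I" "of_int (P i) + of_int (Q i) * w \<in> E r" "r < 4" for i r
    using E_add_J[OF that(2) J_mono[OF _ PQ[OF that(1)], of "r + 1"]] that(3) by simp
  have not4: "of_int (P i) + of_int (Q i) * w \<notin> J 4" if i: "i \<in> I" for i
  proof
    assume "of_int (P i) + of_int (Q i) * w \<in> J 4"
    then have "B i \<in> J 4" using J_add[OF PQ[OF i]] by fastforce
    moreover obtain r where "r \<in> {0, 1, 2, 3}" "B i \<in> E r" using B i by blast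
    ultimately show False using E_not_J[of "B i" r 4] by auto
  qed
  have iff: "(odd (P i) \<longleftrightarrow> B i \<in> E 0) \<and> (even (P i) \<and> odd (Q i) \<longleftrightarrow> B i \<in> E 1)
     \<and> (P i mod 4 = 2 \<and> even (Q i) \<longleftrightarrow> B i \<in> E 2) \<and> (P i mod 4 = 0 \<and> Q i mod 4 = 2 \<longleftrightarrow> B i \<in> E 3)"
    if i: "i \<in> I" for i
  proof -
    have u: "r = r'" if "B i \<in> E r" "B i \<in> E r'" for r r' using E_unique that by blast
    consider "odd (P i)" | "even (P i)" "odd (Q i)" | "P i mod 4 = 2" "even (Q i)" | "P i mod 4 = 0" "Q i mod 4 = 2"
      using level_cases[of "P i" "Q i"] coord_level(5) not4[OF i] by blast
    then show ?thesis
    proof cases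
      case 1
      then have "B i \<in> E 0" using same[OF i coord_level(1)] by simp
      moreover have "P i mod 4 \<noteq> 2" "P i mod 4 \<noteq> 0" using 1 by presburger+
      ultimately show ?thesis using 1 u[of 0 1] u[of 0 2] u[of 0 3] by auto
    next
      case 2
      then have "B i \<in> E 1" using same[OF i coord_level(2)] by simp
      moreover have "Q i mod 4 \<noteq> 2" using 2 by presburger
      ultimately show ?thesis using 2 u[of 1 0] u[of 1 2] u[of 1 3] by auto
    next
      case 3
      then have "B i \<in> E 2" using same[OF i coord_level(3)] by simp
      moreover have "even (P i)" using 3 by presburger
      ultimately show ?thesis using 3 u[of 2 0] u[of 2 1] u[of 2 3] by auto
    next
      case 4
      then have "B i \<in> E 3" using same[OF i coord_level(4)] by simp
      moreover have "even (P i)" "even (Q i)" using 4 by presburger+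
      ultimately show ?thesis using 4 u[of 3 0] u[of 3 1] u[of 3 2] by auto
    qed
  qed
  have lev: "lev0 I = {i \<in> I. B i \<in> E 0}" "lev1 I = {i \<in> I. B i \<in> E 1}"
    "lev2 I = {i \<in> I. B i \<in> E 2}" "lev3 I = {i \<in> I. B i \<in> E 3}"
    unfolding lev0_def lev1_def lev2_def lev3_def
    by (intro Collect_cong conj_cong refl; drule iff; (elim conjE; assumption))+
  have "solvable I" by (rule solvable_if_fits) (unfold lev, rule fits)
  then obtain U where U: "U \<subseteq> I" "cls U True True" "U \<inter> lev0 I \<noteq> {}"
    and alt: "lev0 I - U \<noteq> {} \<and> (U \<inter> lev1 I \<noteq> {} \<or> lev2 I - U \<noteq> {}) \<or> 3 \<le> card (lev0 I - U)"
    unfolding solvable_def by blast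
  have "sum B U \<in> J 4"
  proof -
    have "(\<Sum>i\<in>U. B i - (of_int (P i) + of_int (Q i) * w)) \<in> J 4" using U(1) PQ by (intro J_sum) blast
    moreover have "(\<Sum>i\<in>U. of_int (P i) + of_int (Q i) * w) = of_int (sum P U) + of_int (sum Q U) * w"
      by (simp add: sum.distrib sum_distrib_right)
    moreover have "of_int (sum P U) + of_int (sum Q U) * w \<in> J 4"
      using U(2) unfolding cls_def by (intro coord_level(5)) auto
    ultimately show ?thesis using J_add[of _ 4] by (fastforce simp: sum_subtractf)
  qed
  moreover obtain j where j: "j \<in> U" "B j \<in> E 0" using U(3) lev by blast
  ultimately show ?thesis
  proof -
    assume S: "sum B U \<in> J 4"
    from alt show ?thesis
    proof
      assume *: "lev0 I - U \<noteq> {} \<and> (U \<inter> lev1 I \<noteq> {} \<or> lev2 I - U \<noteq> {})"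
      then obtain i where i: "i \<in> I - U" "B i \<in> E 0" using lev by blast
      obtain k where k: "(k \<in> U \<and> B k \<in> E 1) \<or> (k \<in> I - U \<and> B k \<in> E 2)" using * lev by blast
      show ?thesis by (rule approx_zero_mixed_levels[OF fin U(1) S j i k])
    next
      assume "3 \<le> card (lev0 I - U)"
      then obtain i k l where ik: "i \<in> lev0 I - U" "k \<in> lev0 I - U" "l \<in> lev0 I - U" "i \<noteq> k" "i \<noteq> l" "k \<noteq> l"
        by (rule card_ge_3_obtain)
      then show ?thesis unfolding lev
        by (intro approx_zero_spare_units[OF fin U(1) S j, of i k l]) auto
    qed
  qed
qed

lemma digits_F: "x \<in> digits \<Longrightarrow> x \<in> J 0"
  unfolding digits_def J_0 by (auto intro: O_add)

text \<open>The coefficients are frozen at an index \<open>N\<close> beyond which their valuations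
  and seven leading digits are constant; their valuations modulo 4 are rotated by \<open>t\<close>,
  and the approximate zero so obtained is lifted.\<close>

lemma upper_bound:
  fixes A :: "nat \<Rightarrow> nat \<Rightarrow> complex"
  assumes s: "s \<ge> 11" and F: "\<And>i n. i < s \<Longrightarrow> A i n \<in> F" and cau: "\<And>i. i < s \<Longrightarrow> cauchy (A i)"
    and nz: "\<And>i. i < s \<Longrightarrow> \<not> null (A i)"
  shows "\<exists>Y. (\<forall>i n. Y i n \<in> F) \<and> (\<forall>i<s. cauchy (Y i)) \<and> (\<exists>i<s. \<not> null (Y i))
     \<and> null (\<lambda>n. \<Sum>i<s. A i n * Y i n ^ 4)"
proof -
  have "\<forall>i<s. \<exists>v N. \<forall>n\<ge>N. A i n \<in> E v \<and> (\<forall>m\<ge>N. A i n - A i m \<in> J (v + 7))"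
    using cauchy_leading_term[OF F cau nz, of _ 7] by simp
  then obtain v M where vM: "\<And>i n. i < s \<Longrightarrow> n \<ge> M i \<Longrightarrow> A i n \<in> E (v i)"
      "\<And>i n m. i < s \<Longrightarrow> n \<ge> M i \<Longrightarrow> m \<ge> M i \<Longrightarrow> A i n - A i m \<in> J (v i + 7)"
    by metis
  define N where "N = Max (M ` {..<s})"
  have MN: "M i \<le> N" if "i < s" for i unfolding N_def using that by (intro Max_ge) auto
  define c where "c k = card {i \<in> {..<s}. v i mod 4 = k}" for k :: int
  have "c 0 + c 1 + c 2 + c 3 = s"
  proof -
    have c: "c k = (\<Sum>i<s. if v i mod 4 = k then 1 else 0)" for k
      unfolding c_def by (simp add: sum.If_cases Int_def)
    have "c 0 + c 1 + c 2 + c 3 = (\<Sum>i<s. 1)"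
      unfolding c sum.distrib[symmetric]
    proof (intro sum.cong refl)
      fix i
      have "v i mod 4 = 0 \<or> v i mod 4 = 1 \<or> v i mod 4 = 2 \<or> v i mod 4 = 3" by presburger
      then show "(if v i mod 4 = 0 then 1 else 0) + (if v i mod 4 = 1 then 1 else 0)
        + (if v i mod 4 = 2 then 1 else 0) + (if v i mod 4 = 3 then 1 else 0) = (1 :: nat)" by auto
    qed
    then show ?thesis by simp
  qed
  then have "fits (c 0) (c 1) (c 2) (c 3) \<or> fits (c 1) (c 2) (c 3) (c 0)
      \<or> fits (c 2) (c 3) (c 0) (c 1) \<or> fits (c 3) (c 0) (c 1) (c 2)"
    using s by (intro fits_rotation) simp
  moreover define g where "g t k = card {i \<in> {..<s}. (v i - t) mod 4 = k}" for t k :: int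
  have "g t k = c ((k + t) mod 4)" if "0 \<le> k" "k < 4" for t k
  proof -
    have "(v i - t) mod 4 = k \<longleftrightarrow> v i mod 4 = (k + t) mod 4" for i
    proof -
      have "(v i - t) mod 4 = k \<longleftrightarrow> (v i - t) mod 4 = k mod 4" using that by simp
      also have "\<dots> \<longleftrightarrow> v i mod 4 = (k + t) mod 4" by (simp add: mod_eq_dvd_iff algebra_simps)
      finally show ?thesis .
    qed
    then show ?thesis unfolding g_def c_def by simp
  qed
  then have "g 0 0 = c 0" "g 0 1 = c 1" "g 0 2 = c 2" "g 0 3 = c 3"
     "g 1 0 = c 1" "g 1 1 = c 2" "g 1 2 = c 3" "g 1 3 = c 0"
     "g 2 0 = c 2" "g 2 1 = c 3" "g 2 2 = c 0" "g 2 3 = c 1"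
     "g 3 0 = c 3" "g 3 1 = c 0" "g 3 2 = c 1" "g 3 3 = c 2" by simp_all
  ultimately obtain t where t: "fits (g t 0) (g t 1) (g t 2) (g t 3)" by metis
  \<comment> \<open>Giving the variable a factor \<open>w powi (- k i)\<close> and dividing the form
    by \<open>w powi t\<close> brings the valuation \<open>t + 4 * k i + r i\<close> down to the
    level \<open>r i\<close>.\<close>
  define k where "k i = (v i - t) div 4" for i
  define r where "r i = (v i - t) mod 4" for i
  have vkr: "v i = t + 4 * k i + r i" for i unfolding k_def r_def by simp
  define S where "S i = w powi (- t - 4 * k i)" for i
  have SE: "S i \<in> E (- t - 4 * k i)" for i unfolding S_def by (rule E_powi)
  define B where "B i = S i * A i N" for i
  have BE: "B i \<in> E (r i)" if "i < s" for i
    using E_mult[OF SE vM(1)[OF that MN[OF that]], of i] vkr[of i] by (simp add: B_def)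
  have r4: "r i = 0 \<or> r i = 1 \<or> r i = 2 \<or> r i = 3" for i unfolding r_def by presburger
  have eq: "{i \<in> {..<s}. B i \<in> E m} = {i \<in> {..<s}. (v i - t) mod 4 = m}" for m
    using BE E_unique unfolding r_def by blast
  have "has_approx_zero {..<s} B"
  proof (rule approx_zero_if_fits)
    fix i assume "i \<in> {..<s}"
    then show "\<exists>r\<in>{0, 1, 2, 3}. B i \<in> E r" using BE[of i] r4[of i] by auto
  next
    show "fits (card {i \<in> {..<s}. B i \<in> E 0}) (card {i \<in> {..<s}. B i \<in> E 1})
      (card {i \<in> {..<s}. B i \<in> E 2}) (card {i \<in> {..<s}. B i \<in> E 3})"
      using t unfolding g_def eq .
  qed simp
  then obtain x j where x: "\<And>i. x i \<in> digits" and j: "j < s" "B j \<in> E 0" "x j \<in> {1, 1 + w}"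
    and zero: "(\<Sum>i<s. B i * x i ^ 4) \<in> J 7"
    unfolding has_approx_zero_def by auto
  define X where "X i = x i * w powi (- k i)" for i
  have pw: "(w powi (- k i)) ^ 4 = w powi t * S i" for i
    by (simp add: S_def power_int_power' mult.commute flip: power_int_add)
  have xj: "x j \<in> E 0"
  proof -
    have "1 + w \<in> E 0" using E_add_J[of 1 0 w] E_J[OF E_w, of 1] E_odd[of 1] by simp
    then show ?thesis using j(3) E_odd[of 1] by auto
  qed
  show ?thesis
  proof (rule lift_approximate_zero[where X = X and \<mu> = t and j = j and N = N])
    show "X i \<in> F" for i
      unfolding X_def using digits_F[OF x] E_J[OF E_powi order_refl] J_F by (intro F_mult) blast+
    fix n assume n: "n \<ge> N"
    have summand: "A i n * X i ^ 4 = w powi t * (S i * A i n * x i ^ 4)" for i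
      by (simp add: X_def power_mult_distrib pw algebra_simps)
    have "A j n * X j ^ 4 \<in> E (v j + int 4 * (0 + - k j))"
      using n MN[OF j(1)] unfolding X_def by (intro E_mult E_power vM(1) j xj E_powi) auto
    moreover have "r j = 0" using E_unique BE j by blast
    ultimately show "A j n * X j ^ 4 \<in> E t" using vkr[of j] by simp
    \<comment> \<open>The zero was found for the coefficients at \<open>N\<close>. Moving to
      \<open>n\<close> changes each scaled coefficient only by an element of
      \<open>J (r i + 7)\<close>.\<close>
    have "(\<Sum>i<s. S i * A i n * x i ^ 4) = (\<Sum>i<s. B i * x i ^ 4) + (\<Sum>i<s. S i * (A i n - A i N) * x i ^ 4)"
      by (simp add: B_def sum.distrib[symmetric] algebra_simps)
    moreover have "(\<Sum>i<s. S i * (A i n - A i N) * x i ^ 4) \<in> J 7"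
    proof (rule J_sum)
      fix i assume i: "i \<in> {..<s}"
      have "S i * (A i n - A i N) * x i ^ 4 \<in> J ((- t - 4 * k i) + (v i + 7) + int 4 * 0)"
        using i n MN[of i] E_J[OF SE order_refl] digits_F[OF x] by (intro J_mult J_power vM(2)) auto
      then show "S i * (A i n - A i N) * x i ^ 4 \<in> J 7"
        using vkr[of i] r4[of i] by (elim J_mono[rotated]) auto
    qed
    ultimately have "(\<Sum>i<s. S i * A i n * x i ^ 4) \<in> J 7" using zero J_add by simp
    then have "w powi t * (\<Sum>i<s. S i * A i n * x i ^ 4) \<in> J (t + 7)"
      by (simp add: J_powi_mult)
    then show "(\<Sum>i<s. A i n * X i ^ 4) \<in> J (t + 7)" by (simp add: summand sum_distrib_left)
  qed (use j cau in auto)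
qed

section \<open>Back to forms over \<open>K\<close>\<close>

lemma has_nontrivial_zero_iff:
  "has_nontrivial_zero d e s a \<longleftrightarrow> (\<exists>Y. (\<forall>i n. Y i n \<in> F) \<and> (\<forall>i<s. cauchy (Y i)) \<and> (\<exists>i<s. \<not> null (Y i))
     \<and> null (\<lambda>n. \<Sum>i<s. emb (a i n) * Y i n ^ e))"
proof
  assume "has_nontrivial_zero d e s a"
  then obtain x where "\<forall>i<s. is_K_elem (x i)" "\<exists>i<s. \<not> is_K_zero (x i)" "is_K_zero (diag_form d e s a x)"
    unfolding has_nontrivial_zero_def by blast
  then show "\<exists>Y. (\<forall>i n. Y i n \<in> F) \<and> (\<forall>i<s. cauchy (Y i)) \<and> (\<exists>i<s. \<not> null (Y i))
     \<and> null (\<lambda>n. \<Sum>i<s. emb (a i n) * Y i n ^ e)"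
    unfolding is_K_elem_iff is_K_zero_iff emb_diag_form
    by (intro exI[of _ "\<lambda>i n. emb (x i n)"]) (simp add: F_emb)
next
  assume "\<exists>Y. (\<forall>i n. Y i n \<in> F) \<and> (\<forall>i<s. cauchy (Y i)) \<and> (\<exists>i<s. \<not> null (Y i))
     \<and> null (\<lambda>n. \<Sum>i<s. emb (a i n) * Y i n ^ e)"
  then obtain Y where Y: "\<And>i n. Y i n \<in> F" "\<forall>i<s. cauchy (Y i)" "\<exists>i<s. \<not> null (Y i)"
     "null (\<lambda>n. \<Sum>i<s. emb (a i n) * Y i n ^ e)" by blast
  have "\<forall>i n. \<exists>p. emb p = Y i n" using Y(1) unfolding F_emb by (metis rangeE)
  then obtain x where x: "\<And>i n. emb (x i n) = Y i n" by metis
  have "Y i = (\<lambda>n. emb (x i n))" for i using x by (simp add: fun_eq_iff)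
  then show "has_nontrivial_zero d e s a"
    unfolding has_nontrivial_zero_def is_K_elem_iff is_K_zero_iff emb_diag_form
    using Y(2-4) x by (intro exI[of _ x]) simp
qed

text \<open>A coefficient that is zero in \<open>K\<close> has no valuation and is treated apart:
  its variable is 1 and all others vanish.\<close>

lemma isotropic_ge_11:
  assumes s: "s \<ge> 11" and a: "\<And>i. i < s \<Longrightarrow> is_K_elem (a i)"
  shows "has_nontrivial_zero d 4 s a"
proof (cases "\<exists>i<s. null (\<lambda>n. emb (a i n))")
  case True
  then obtain j where j: "j < s" "null (\<lambda>n. emb (a j n))" by blast
  define Y :: "nat \<Rightarrow> nat \<Rightarrow> complex" where "Y i n = (if i = j then 1 else 0)" for i n
  have "\<not> null (Y j)"
  proof
    assume "null (Y j)"
    then obtain N where "Y j N \<in> J 1" unfolding null_def by blast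
    then show False using E_odd[of 1] by (simp add: Y_def E_def)
  qed
  moreover have "(\<Sum>i<s. emb (a i n) * Y i n ^ 4) = emb (a j n)" for n
  proof -
    have "(\<Sum>i<s. emb (a i n) * Y i n ^ 4) = (\<Sum>i<s. if i = j then emb (a i n) else 0)"
      by (intro sum.cong) (auto simp: Y_def)
    then show ?thesis using j(1) by simp
  qed
  ultimately show ?thesis unfolding has_nontrivial_zero_iff using j
    by (intro exI[of _ Y]) (auto simp: Y_def O_F cauchy_def)
next
  case False
  have "emb (a i n) \<in> F" for i n by (simp add: F_emb)
  then show ?thesis unfolding has_nontrivial_zero_iff
    using upper_bound[OF s, of "\<lambda>i n. emb (a i n)"] a False by (simp add: is_K_elem_iff)
qed

text \<open>The pair for \<open>i \<ge> 4\<close> stands for \<open>w * (1 + twist * w)\<close>,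
  because \<open>w ^ 2 = d\<close>.\<close>

definition coef :: "nat \<Rightarrow> rat \<times> rat" where
  "coef i = (if i < 4 then (1, 0) else (of_int (twist * d), 1))"

lemma emb_coef: "emb (coef i) = (if i < 4 then 1 else w * (1 + of_int twist * w))"
proof -
  have "w * (1 + of_int twist * w) = of_int (twist * d) + w" using w_sq(1) by (simp add: algebra_simps)
  moreover have "of_rat (of_int (twist * d)) = (of_int (twist * d) :: complex)" by (rule of_rat_of_int_eq)
  ultimately show ?thesis by (simp add: coef_def emb_def del: of_int_mult)
qed

text \<open>At one late index the values are padded with zeros to ten and divided by a power of
  \<open>w\<close> so that their minimal valuation is 0; this contradicts
  \<open>anisotropic\<close>.\<close>

lemma anisotropic_le_10:
  assumes d: "d \<in> {2, 10, -2, -10}" and s: "s \<le> 10"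
  shows "\<not> has_nontrivial_zero d 4 s (\<lambda>i n. coef i)"
proof
  assume "has_nontrivial_zero d 4 s (\<lambda>i n. coef i)"
  then obtain Y i0 where F: "\<And>i n. Y i n \<in> F" and cau: "\<And>i. i < s \<Longrightarrow> cauchy (Y i)"
    and i0: "i0 < s" "\<not> null (Y i0)" and zero: "null (\<lambda>n. \<Sum>i<s. emb (coef i) * Y i n ^ 4)"
    unfolding has_nontrivial_zero_iff by blast
  obtain v N where v: "\<forall>n\<ge>N. Y i0 n \<in> E v"
    using cauchy_leading_term[OF F cau[OF i0(1)] i0(2), of 1] by auto
  \<comment> \<open>The minimal valuation found below is at most \<open>v\<close>, so precision
    \<open>8 + 4 * v\<close> leaves at least eight digits after rescaling.\<close>
  obtain N' where N': "\<forall>n\<ge>N'. (\<Sum>i<s. emb (coef i) * Y i n ^ 4) \<in> J (8 + 4 * v)"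
    using zero unfolding null_def by blast
  define n where "n = max N N'"
  define y where "y i = (if i < s then Y i n else 0)" for i
  have yv: "y i0 \<in> E v" using v i0 by (simp add: y_def n_def)
  define V where "V = {m. \<exists>i<10. y i \<in> E m}"
  have vV: "v \<in> V" unfolding V_def using yv i0(1) s by (intro CollectI exI[of _ i0]) simp
  have "finite V"
  proof (rule finite_subset)
    show "V \<subseteq> (\<lambda>i. THE m. y i \<in> E m) ` {..<10}"
    proof
      fix m assume "m \<in> V"
      then obtain i where i: "i < 10" "y i \<in> E m" unfolding V_def by blast
      then have "(THE m. y i \<in> E m) = m" using E_unique by blast
      then show "m \<in> (\<lambda>i. THE m. y i \<in> E m) ` {..<10}" using i by force
    qed
  qed simp
  define \<mu> where "\<mu> = Min V"
  have \<mu>: "\<mu> \<in> V" "\<mu> \<le> v" using Min_in[OF \<open>finite V\<close>] Min_le[OF \<open>finite V\<close> vV] vV by (auto simp: \<mu>_def)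
  define z where "z i = w powi (- \<mu>) * y i" for i
  have "z i \<in> J 0" if "i < 10" for i
  proof (cases "y i = 0")
    case False
    then obtain m where m: "y i \<in> E m" using F_E[of "y i"] F by (auto simp: y_def split: if_splits)
    then have "\<mu> \<le> m" unfolding \<mu>_def using that \<open>finite V\<close> by (intro Min_le) (auto simp: V_def)
    then show ?thesis using E_J[OF m, of \<mu>] by (simp add: z_def J_powi_mult)
  qed (simp add: z_def)
  moreover obtain i1 where "i1 < 10" "y i1 \<in> E \<mu>" using \<mu>(1) unfolding V_def by blast
  moreover from this have "z i1 \<in> E 0" by (simp add: z_def E_powi_mult)
  ultimately have no: "(\<Sum>i<4. z i ^ 4) + w * (1 + of_int twist * w) * (\<Sum>i=4..<10. z i ^ 4) \<notin> J 8"
    by (intro anisotropic[OF d]) auto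
  have "(\<Sum>i<s. emb (coef i) * Y i n ^ 4) = (\<Sum>i<10. emb (coef i) * y i ^ 4)"
    using s by (intro sum.mono_neutral_cong_left) (auto simp: y_def)
  also have "\<dots> = (\<Sum>i<4. y i ^ 4) + w * (1 + of_int twist * w) * (\<Sum>i=4..<10. y i ^ 4)"
  proof -
    have split: "{..<10} = {..<4} \<union> {4..<10 :: nat}" by auto
    have "(\<Sum>i<10. emb (coef i) * y i ^ 4) = (\<Sum>i<4. emb (coef i) * y i ^ 4) + (\<Sum>i=4..<10. emb (coef i) * y i ^ 4)"
      unfolding split by (rule sum.union_disjoint) auto
    then show ?thesis by (simp add: emb_coef sum_distrib_left)
  qed
  finally have eq: "(\<Sum>i<s. emb (coef i) * Y i n ^ 4)
    = (\<Sum>i<4. y i ^ 4) + w * (1 + of_int twist * w) * (\<Sum>i=4..<10. y i ^ 4)" .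
  have tot: "(\<Sum>i<4. y i ^ 4) + w * (1 + of_int twist * w) * (\<Sum>i=4..<10. y i ^ 4) \<in> J (8 + 4 * v)"
    using N' unfolding eq[symmetric] by (simp add: n_def)
  have "z i ^ 4 = w powi (- 4 * \<mu>) * y i ^ 4" for i
    by (simp add: z_def power_mult_distrib power_int_power' mult.commute)
  then have "(\<Sum>i<4. z i ^ 4) + w * (1 + of_int twist * w) * (\<Sum>i=4..<10. z i ^ 4)
    = w powi (- 4 * \<mu>) * ((\<Sum>i<4. y i ^ 4) + w * (1 + of_int twist * w) * (\<Sum>i=4..<10. y i ^ 4))"
    by (simp add: sum_distrib_left[symmetric] distrib_left mult.left_commute)
  moreover have "\<dots> \<in> J 8" unfolding J_powi_mult using \<mu>(2) by (intro J_mono[OF _ tot]) simp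
  ultimately show False using no by simp
qed

lemma coef_K_elem: "is_K_elem (\<lambda>n. coef i)"
  by (simp add: is_K_elem_iff cauchy_const)

end

theorem theorem1:
  fixes d :: int
  assumes "d \<in> {2, 10, -2, -10}"
  shows "Gamma_star d 4 = 11
    \<and> (\<forall>s\<ge>11. \<forall>a. (\<forall>i<s. is_K_elem (a i)) \<longrightarrow> has_nontrivial_zero d 4 s a)
    \<and> (\<exists>a. (\<forall>i<10. is_K_elem (a i)) \<and> \<not> has_nontrivial_zero d 4 10 a)"
proof -
  interpret ramified d by standard (use assms in auto)
  have upper: "\<forall>s\<ge>11. \<forall>a. (\<forall>i<s. is_K_elem (a i)) \<longrightarrow> has_nontrivial_zero d 4 s a"
    by (intro allI impI isotropic_ge_11) auto
  moreover have "\<exists>a. (\<forall>i<10. is_K_elem (a i)) \<and> \<not> has_nontrivial_zero d 4 10 a"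
    by (intro exI[of _ "\<lambda>i n. coef i"]) (simp add: coef_K_elem anisotropic_le_10[OF assms])
  moreover have "Gamma_star d 4 = 11"
    unfolding Gamma_star_def
  proof (rule Least_equality)
    \<comment> \<open>Minimality has to exclude every length up to 10; zero padding in
      \<open>anisotropic_le_10\<close> covers them all with the same coefficients.\<close>
    fix s assume "\<forall>a. (\<forall>i<s. is_K_elem (a i)) \<longrightarrow> has_nontrivial_zero d 4 s a"
    then have "has_nontrivial_zero d 4 s (\<lambda>i n. coef i)"
      by (elim allE[of _ "\<lambda>i n. coef i"]) (simp add: coef_K_elem)
    then show "11 \<le> s" using anisotropic_le_10[OF assms, of s] by linarith
  qed (use upper in simp)
  ultimately show ?thesis by blast
qed

end
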